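(* Let $\mathbb{F}=\mathbb{R}$ or $\mathbb{F}=\mathbb{C}$, let $m,n$ be positive integers, and let $\underline{d}=(d_1,\ldots,d_m)$ be a list of nonnegative integers with $\max_{1\le i\le m} d_i>0$. Let $M(\lambda)\in\mathbb{F}[\lambda]^{m\times(m+n)}_{\underline{d}}$ be a polynomial matrix with full-trimmed-Sylvester-rank, let $k'=\left\lceil \frac{\sum_{i=1}^m d_i}{n}\right\rceil$, and let $t$ be defined by $nk'=\sum_{i=1}^m d_i+t$ (so $0\le t<n$). Then the following statements hold. (a) If $k'>1$ and $t>0$, then every $\widetilde M(\lambda)\in\mathbb{F}[\lambda]^{m\times(m+n)}_{\underline{d}}$ such that $$\|T_1(M)-T_1(\widetilde M)\|_2<\min\left\{\frac{\sigma_{(k'-1)(m+n)}(T_{k'-1}(M))}{\sqrt{k'-1}}\,,\ \frac{\sigma_{k'm+\sum_{i=1}^m d_i}(T_{k'}(M))}{\sqrt{k'}}\right\}$$ has full-trimmed-Sylvester-rank. (b) If $k'=1$ or $t=0$, then every $\widetilde M(\lambda)\in\mathbb{F}[\lambda]^{m\times(m+n)}_{\underline{d}}$ such that $$\|T_1(M)-T_1(\widetilde M)\|_2<\frac{\sigma_{k'm+\sum_{i=1}^m d_i}(T_{k'}(M))}{\sqrt{k'}}$$ has full-trimmed-Sylvester-rank.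
   Context: Space: $\mathbb{F}[\lambda]^{m\times(m+n)}_{\underline{d}}$ is the $\mathbb{F}$-linear space of $m\times(m+n)$ polynomial matrices $M(\lambda)$ whose $i$th row has the form $R_i(\lambda)=R_{i,0}+R_{i,1}\lambda+\cdots+R_{i,d_i}\lambda^{d_i}$ with $R_{i,j}\in\mathbb{F}^{1\times(m+n)}$, $i=1,\ldots,m$. Trimmed Sylvester matrices: put $d=\max_i d_i$ and write $M(\lambda)=M_0+M_1\lambda+\cdots+M_d\lambda^d$. For $k\ge1$, the $k$th Sylvester matrix $S_k(M)\in\mathbb{F}^{(k+d)m\times k(m+n)}$ is the block matrix with $k+d$ block rows (indexed $0,\ldots,k+d-1$) and $k$ block columns (indexed $0,\ldots,k-1$) whose $(p,q)$ block is $M_{p-q}$ if $0\le p-q\le d$ and $0$ otherwise. The $k$th trimmed Sylvester matrix $T_k(M)\in\mathbb{F}^{(km+\sum_{i=1}^m d_i)\times k(m+n)}$ is obtained from $S_k(M)$ by deleting, for every $i=1,\ldots,m$, the $i$th row of each of the last $d-d_i$ block rows (these rows are always zero), keeping the order of the remaining rows. $M(\lambda)$ has full-trimmed-Sylvester-rank if $\operatorname{rank} T_k(M)=\min\{km+\sum_{i=1}^m d_i,\;k(m+n)\}$ for all $k=1,2,\ldots$. Notation: $\|\cdot\|_2$ is the spectral norm; $\sigma_1(A)\ge\cdots\ge\sigma_{\min\{p,q\}}(A)$ are the singular values of $A\in\mathbb{F}^{p\times q}$. *)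

theory Defs
  imports
    "HOL-Analysis.L2_Norm"
    "HOL-Computational_Algebra.Polynomial"
    "Jordan_Normal_Form.Char_Poly"
    "Jordan_Normal_Form.DL_Rank"
    "Jordan_Normal_Form.Schur_Decomposition"
begin

text \<open>
  Polynomial matrices are matrices with polynomial entries. Rows are numbered from 0 and the list
  \<open>d\<close> gives the row degree bounds, so \<open>d ! i\<close> bounds the degree of row \<open>i\<close>.
\<close>

definition row_degree_mats :: "nat \<Rightarrow> nat \<Rightarrow> nat list \<Rightarrow> 'a::zero poly mat set" where
  "row_degree_mats m n d =
     {M \<in> carrier_mat m (m + n). \<forall>i<m. \<forall>j<m + n. degree (M $$ (i, j)) \<le> d ! i}"

text \<open>
  Row \<open>r\<close> of the Sylvester matrix is row \<open>r mod m\<close> of block row \<open>r div m\<close>, where \<open>m = dim_row M\<close>;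
  columns likewise with \<open>dim_col M\<close>. The coefficient matrix of \<open>\<lambda>\<^sup>s\<close> in \<open>M\<close> has entries
  \<open>coeff (M $$ (i, j)) s\<close>.
\<close>

definition sylvester :: "nat list \<Rightarrow> nat \<Rightarrow> 'a::zero poly mat \<Rightarrow> 'a mat" where
  "sylvester d k M =
     (let m = dim_row M; w = dim_col M; D = Max (set d) in
      mat ((k + D) * m) (k * w)
        (\<lambda>(r, c). let p = r div m; q = c div w in
           if q \<le> p \<and> p - q \<le> D then coeff (M $$ (r mod m, c mod w)) (p - q) else 0))"

definition trimmed_sylvester :: "nat list \<Rightarrow> nat \<Rightarrow> 'a::zero poly mat \<Rightarrow> 'a mat" where
  "trimmed_sylvester d k M =
     (let m = dim_row M; D = Max (set d); S = sylvester d k M in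
      mat_of_rows (dim_col S)
        (map (row S)
          (filter (\<lambda>r. r div m < (k + D) - (D - d ! (r mod m))) [0..<dim_row S])))"

definition full_trimmed_sylvester_rank :: "nat list \<Rightarrow> 'a::field poly mat \<Rightarrow> bool" where
  "full_trimmed_sylvester_rank d M \<longleftrightarrow>
     (\<forall>k\<ge>1. let T = trimmed_sylvester d k M in
        vec_space.rank (dim_row T) T
          = min (k * dim_row M + sum_list d) (k * dim_col M))"

definition vec_norm2 :: "'a::real_normed_vector vec \<Rightarrow> real" where
  "vec_norm2 v = L2_set (\<lambda>i. norm (v $ i)) {..<dim_vec v}"

definition spectral_norm :: "'a::real_normed_field mat \<Rightarrow> real" where
  "spectral_norm A =
     (SUP v\<in>{v \<in> carrier_vec (dim_col A). vec_norm2 v = 1}. vec_norm2 (A *\<^sub>v v))"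

text \<open>
  The singular values of a \<open>p \<times> q\<close> matrix \<open>A\<close> are the \<open>min p q\<close> largest square roots of the
  eigenvalues of \<open>A\<^sup>* A\<close>, counted with algebraic multiplicity, in nonincreasing order. The definition
  is meant for real and complex matrices: there the characteristic polynomial of \<open>A\<^sup>* A\<close> splits with
  real nonnegative roots, so that \<open>norm\<close> only converts an eigenvalue to type \<^typ>\<open>real\<close>.
\<close>

definition singular_values :: "'a::{conjugatable_field, real_normed_field} mat \<Rightarrow> real list" where
  "singular_values A =
     take (min (dim_row A) (dim_col A))
       (rev (sorted_list_of_multiset
          (image_mset (\<lambda>x. sqrt (norm x)) (proots (char_poly (mat_adjoint A * A))))))"

text \<open>Singular values are numbered from 1, unlike list positions.\<close>

definition singular_value :: "nat \<Rightarrow> 'a::{conjugatable_field, real_normed_field} mat \<Rightarrow> real" where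
  "singular_value j A = singular_values A ! (j - 1)"

end

theory Submission
  imports Defs
begin

text \<open>
  Multiplication by \<open>T\<^sub>k(M)\<close> is the map \<open>x \<mapsto> M x\<close> on polynomial vectors of degree less than \<open>k\<close>, with
  values in the polynomial vectors whose \<open>i\<close>th entry has degree less than \<open>k + d\<^sub>i\<close>. Injectivity
  therefore passes from \<open>k\<close> to smaller indices and surjectivity from \<open>k\<close> to larger ones, so full
  trimmed Sylvester rank is decided by \<open>T\<^bsub>k'-1\<^esub>\<close> and \<open>T\<^bsub>k'\<^esub>\<close>, and by \<open>T\<^bsub>k'\<^esub>\<close> alone if it is square or if
  \<open>k' = 1\<close>. Since \<open>T\<^sub>k(M) x\<close> is a sum of \<open>k\<close> shifted copies of products with \<open>T\<^sub>1(M)\<close>, the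
  Cauchy-Schwarz inequality gives \<open>\<parallel>T\<^sub>k(M)\<parallel> \<le> \<surd>k \<parallel>T\<^sub>1(M)\<parallel>\<close>. Finally, if \<open>\<parallel>E\<parallel> < \<sigma>\<^sub>j(A)\<close>, then
  \<open>A - E\<close> is injective on a \<open>j\<close>-dimensional space where \<open>\<parallel>A x\<parallel> \<ge> \<sigma>\<^sub>j(A) \<parallel>x\<parallel>\<close>. The same argument
  covers the real and the complex case, except for the splitting of the characteristic polynomial
  of \<open>A\<^sup>* A\<close>.
\<close>

section \<open>Rank and injectivity\<close>

lemma mult_unit_vec:
  fixes C :: "'a :: semiring_1 mat"
  assumes "C \<in> carrier_mat n q" "a < q"
  shows "C *\<^sub>v unit_vec q a = col C a"
  using assms by (intro eq_vecI) auto

lemma mult_zero_vec: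
  fixes C :: "'a :: semiring_1 mat"
  assumes "C \<in> carrier_mat n q"
  shows "C *\<^sub>v 0\<^sub>v q = 0\<^sub>v n"
  using assms by (intro eq_vecI) auto

text \<open>The columns of \<open>A * P\<close> lie in the column space of \<open>A\<close>, and
  injectivity makes them \<open>j\<close> independent vectors there. The factor \<open>P\<close>
  serves both later uses: the identity when \<open>A\<close> is injective, a right inverse when
  \<open>A\<close> is surjective.\<close>

lemma vec_space_rank_ge:
  fixes A :: "'a :: field mat"
  assumes A: "A \<in> carrier_mat n q" and P: "P \<in> carrier_mat q j"
    and inj: "\<And>z. z \<in> carrier_vec j \<Longrightarrow> A * P *\<^sub>v z = 0\<^sub>v n \<Longrightarrow> z = 0\<^sub>v j"
  shows "j \<le> vec_space.rank n A"
proof -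
  interpret vec_space "TYPE('a)" n .
  define C where "C = A * P"
  have C: "C \<in> carrier_mat n j" using A P by (simp add: C_def)
  \<comment> \<open>Independence concerns the set of columns, whose cardinality is \<open>j\<close>
    only without repetitions; two equal columns would put a difference of unit vectors into the
    kernel.\<close>
  have dist: "distinct (cols C)"
  proof (rule ccontr)
    assume "\<not> distinct (cols C)"
    then obtain a b where ab: "a < j" "b < j" "a \<noteq> b" "col C a = col C b"
      using C by (auto simp: distinct_conv_nth)
    have "C *\<^sub>v (unit_vec j a - unit_vec j b) = 0\<^sub>v n"
      using C ab mult_unit_vec[OF C] by (simp add: mult_minus_distrib_mat_vec[of _ n j])
    then have "unit_vec j a - unit_vec j b = (0\<^sub>v j :: 'a vec)"
      using inj by (simp add: C_def)
    then have "(unit_vec j a - unit_vec j b) $ a = (0\<^sub>v j :: 'a vec) $ a" by simp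
    then show False using ab by simp
  qed
  have indpt: "lin_indpt (set (cols C))"
    using lin_depE[OF C _ dist] inj unfolding C_def by metis
  let ?S = "span (set (cols A))"
  have colsA: "set (cols A) \<subseteq> carrier_vec n" using A cols_dim by blast
  have "set (cols C) \<subseteq> ?S"
  proof
    fix v assume "v \<in> set (cols C)"
    then obtain l where l: "l < j" "v = col C l" using C by (auto simp: cols_def)
    then have "v = A *\<^sub>v col P l" unfolding C_def using A P by (auto intro!: eq_vecI)
    then show "v \<in> ?S"
      using col_space_eq[OF A] A P l unfolding col_space_def by auto
  qed
  moreover have "submodule class_ring ?S V" using colsA by (rule span_is_submodule)
  \<comment> \<open>The rank is the dimension of the column span as a space of its own, so
    independence is carried from the ambient space to that subspace.\<close>
  ultimately have indpt': "LinearCombinations.module.lin_indpt class_ring (vs ?S) (set (cols C))"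
    using span_li_not_depend(2) indpt by blast
  have sub: "vectorspace class_ring (vs ?S)"
    using colsA span_is_subspace subspace_is_vs by blast
  have "card (set (cols C)) \<le> vectorspace.dim class_ring (vs ?S)"
    using \<open>set (cols C) \<subseteq> ?S\<close> indpt' fin_dim_span_cols[OF A]
    by (intro vectorspace.li_le_dim(2)[OF sub]) auto
  then show ?thesis
    using distinct_card[OF dist] C by (simp add: rank_def)
qed

lemma vec_space_rank_le_nr:
  fixes A :: "'a :: field mat"
  assumes A: "A \<in> carrier_mat n q"
  shows "vec_space.rank n A \<le> n"
proof -
  interpret vec_space "TYPE('a)" n .
  obtain S where S: "maximal S (\<lambda>T. T \<subseteq> set (cols A) \<and> lin_indpt T)"
    using maximal_exists[of "(\<lambda>T. T \<subseteq> set (cols A) \<and> lin_indpt T)" "card (set (cols A))" "{}"]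
    by (meson List.finite_set card_mono empty_iff empty_subsetI finite_lin_indpt2 rev_finite_subset)
  then have "S \<subseteq> carrier_vec n" "lin_indpt S"
    using cols_dim A unfolding maximal_def by blast+
  then have "card S \<le> n" using li_le_dim(2)[of S] by (simp add: dim_is_n)
  then show ?thesis using rank_card_indpt[OF A S] by simp
qed

lemma mult_mat_vec_inj_imp_surj:
  fixes C :: "'a :: field mat"
  assumes C: "C \<in> carrier_mat n n"
    and inj: "\<And>z. z \<in> carrier_vec n \<Longrightarrow> C *\<^sub>v z = 0\<^sub>v n \<Longrightarrow> z = 0\<^sub>v n"
    and v: "v \<in> carrier_vec n"
  obtains z where "z \<in> carrier_vec n" "C *\<^sub>v z = v"
proof -
  have "det C \<noteq> 0" using det_0_iff_vec_prod_zero_field[OF C] inj by blast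
  then obtain D where D: "D \<in> carrier_mat n n" "C * D = 1\<^sub>m n"
    using det_non_zero_imp_unit[OF C, of UNIV]
    unfolding Units_def by (auto simp: ring_mat_def)
  have "C *\<^sub>v (D *\<^sub>v v) = v"
    using assoc_mult_mat_vec[OF C D(1) v] D(2) v by simp
  then show thesis using that[of "D *\<^sub>v v"] D(1) v by simp
qed

section \<open>Norms and singular values\<close>

text \<open>Lets the real and the complex case share one proof. The axiom ties the conjugate, which
  gives the inner product, to the norm, which gives \<open>vec_norm2\<close>;
  \<open>scaleR _ 1\<close> is the embedding of the reals.\<close>

class normed_conjugatable_field = conjugatable_ordered_field + real_normed_field +
  assumes mult_conjugate_eq_norm: "x * conjugate x = scaleR ((norm x)\<^sup>2) 1"

instance real :: normed_conjugatable_field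
  by standard (simp add: power2_eq_square)

instance complex :: normed_conjugatable_field
  by standard (simp only: conjugate_complex_def complex_norm_square[symmetric] scaleR_conv_of_real mult_1_right)

section \<open>Euclidean norm, adjoint and Gram matrix\<close>

lemma vec_norm2_nonneg: "vec_norm2 v \<ge> 0"
  by (simp add: vec_norm2_def)

lemma vec_norm2_squared: "(vec_norm2 v)\<^sup>2 = (\<Sum>i<dim_vec v. (norm (v $ i))\<^sup>2)"
  by (simp add: vec_norm2_def L2_set_def sum_nonneg)

lemma vec_norm2_eq_0_iff:
  assumes "v \<in> carrier_vec n"
  shows "vec_norm2 v = 0 \<longleftrightarrow> v = 0\<^sub>v n"
  using assms by (auto simp: vec_norm2_def L2_set_eq_0_iff)

lemma vec_norm2_smult: "vec_norm2 (a \<cdot>\<^sub>v v) = norm a * vec_norm2 v"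
  for a :: "'a :: real_normed_field"
  by (simp add: vec_norm2_def norm_mult L2_set_right_distrib cong: L2_set_cong_simp)

lemma cscalar_prod_self:
  fixes v :: "'a :: normed_conjugatable_field vec"
  shows "v \<bullet>c v = of_real ((vec_norm2 v)\<^sup>2)"
  by (simp add: scalar_prod_def vec_norm2_squared mult_conjugate_eq_norm scaleR_conv_of_real atLeast0LessThan)

lemma cscalar_prod_commute:
  fixes v w :: "'a :: conjugatable_field vec"
  assumes "v \<in> carrier_vec n" "w \<in> carrier_vec n"
  shows "w \<bullet>c v = conjugate (v \<bullet>c w)"
  using assms by (simp add: scalar_prod_def sum_conjugate conjugate_dist_mul mult.commute)

lemma cscalar_prod_add_left:
  fixes u v w :: "'a :: conjugatable_field vec"
  assumes "u \<in> carrier_vec n" "v \<in> carrier_vec n" "w \<in> carrier_vec n"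
  shows "(u + v) \<bullet>c w = u \<bullet>c w + v \<bullet>c w"
  using assms by (simp add: add_scalar_prod_distrib[of _ n])

lemma cscalar_prod_minus_left:
  fixes u v w :: "'a :: conjugatable_field vec"
  assumes "u \<in> carrier_vec n" "v \<in> carrier_vec n" "w \<in> carrier_vec n"
  shows "(u - v) \<bullet>c w = u \<bullet>c w - v \<bullet>c w"
  using assms by (simp add: minus_scalar_prod_distrib[of _ n])

lemma cscalar_prod_smult_left:
  fixes u w :: "'a :: conjugatable_field vec"
  assumes "u \<in> carrier_vec n" "w \<in> carrier_vec n"
  shows "(a \<cdot>\<^sub>v u) \<bullet>c w = a * (u \<bullet>c w)"
  using assms by simp

lemma vec_norm2_pythagoras:
  fixes v w :: "'a :: normed_conjugatable_field vec"
  assumes v: "v \<in> carrier_vec n" and w: "w \<in> carrier_vec n" and 0: "v \<bullet>c w = 0"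
  shows "(vec_norm2 (v + w))\<^sup>2 = (vec_norm2 v)\<^sup>2 + (vec_norm2 w)\<^sup>2"
proof -
  have 1: "w \<bullet>c v = 0" using cscalar_prod_commute[OF v w] 0 by simp
  have "(v + w) \<bullet>c (v + w) = v \<bullet>c (v + w) + w \<bullet>c (v + w)"
    using v w by (simp add: cscalar_prod_add_left[of _ n])
  also have "v \<bullet>c (v + w) = v \<bullet>c v"
    using v w 0 by (simp add: conjugate_add_vec[of _ n] scalar_prod_add_distrib[of _ n])
  also have "w \<bullet>c (v + w) = w \<bullet>c w"
    using v w 1 by (simp add: conjugate_add_vec[of _ n] scalar_prod_add_distrib[of _ n])
  finally have "(of_real ((vec_norm2 (v + w))\<^sup>2) :: 'a) =
      of_real ((vec_norm2 v)\<^sup>2 + (vec_norm2 w)\<^sup>2)"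
    by (simp only: cscalar_prod_self of_real_add)
  then show ?thesis by (simp only: of_real_eq_iff)
qed

lemma mat_adjoint_carrier:
  fixes A :: "'a :: conjugatable_field mat"
  assumes "A \<in> carrier_mat p q"
  shows "mat_adjoint A \<in> carrier_mat q p"
  using assms by (auto simp: mat_adjoint_def)

lemma mat_adjoint_index:
  fixes A :: "'a :: conjugatable_field mat"
  assumes "A \<in> carrier_mat p q" "i < q" "j < p"
  shows "mat_adjoint A $$ (i, j) = conjugate (A $$ (j, i))"
  using assms by (simp add: mat_adjoint_def mat_of_rows_index)

lemma cscalar_prod_mat_adjoint:
  fixes A :: "'a :: conjugatable_field mat"
  assumes A: "A \<in> carrier_mat p q" and z: "z \<in> carrier_vec p" and y: "y \<in> carrier_vec q"
  shows "(mat_adjoint A *\<^sub>v z) \<bullet>c y = z \<bullet>c (A *\<^sub>v y)"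
proof -
  have "(mat_adjoint A *\<^sub>v z) \<bullet>c y
      = (\<Sum>i<q. \<Sum>j<p. conjugate (A $$ (j, i)) * z $ j * conjugate (y $ i))"
    using assms mat_adjoint_carrier[OF A]
    by (simp add: scalar_prod_def row_def atLeast0LessThan mat_adjoint_index[OF A] sum_distrib_right)
  also have "\<dots> = (\<Sum>j<p. \<Sum>i<q. conjugate (A $$ (j, i)) * z $ j * conjugate (y $ i))"
    by (rule sum.swap)
  also have "\<dots> = z \<bullet>c (A *\<^sub>v y)"
    using assms
    by (simp add: scalar_prod_def row_def atLeast0LessThan sum_distrib_left sum_conjugate
        conjugate_dist_mul mult_ac)
  finally show ?thesis .
qed

lemma cscalar_prod_gram:
  fixes A :: "'a :: conjugatable_field mat"
  assumes A: "A \<in> carrier_mat p q" and x: "x \<in> carrier_vec q" and y: "y \<in> carrier_vec q"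
  shows "(mat_adjoint A * A *\<^sub>v x) \<bullet>c y = (A *\<^sub>v x) \<bullet>c (A *\<^sub>v y)"
  using cscalar_prod_mat_adjoint[OF A _ y, of "A *\<^sub>v x"] A x mat_adjoint_carrier[OF A]
  by (simp add: assoc_mult_mat_vec[of _ q p _ q])

text \<open>
  The orthogonal complement \<open>u\<close> of \<open>V i\<close> in \<open>V (Suc i)\<close> is an eigenvector, because the Gram matrix
  leaves both \<open>V i\<close> and its orthogonal complement invariant; the Rayleigh quotient bound then
  propagates along the flag by Pythagoras.
\<close>

lemma gram_flag_bound:
  fixes A :: "'a :: normed_conjugatable_field mat" and V :: "nat \<Rightarrow> 'a vec set"
  defines "H \<equiv> mat_adjoint A * A"
  assumes A: "A \<in> carrier_mat p q"
    and V0: "V 0 = {0\<^sub>v q}"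
    and V_Suc: "\<And>i. i < j \<Longrightarrow> V (Suc i) = {a \<cdot>\<^sub>v b i + y | a y. y \<in> V i}"
    and V_carrier: "\<And>i. V i \<subseteq> carrier_vec q"
    and V_add: "\<And>i x y. x \<in> V i \<Longrightarrow> y \<in> V i \<Longrightarrow> x + y \<in> V i"
    and V_smult: "\<And>i a x. x \<in> V i \<Longrightarrow> a \<cdot>\<^sub>v x \<in> V i"
    and V_H: "\<And>i x. x \<in> V i \<Longrightarrow> H *\<^sub>v x \<in> V i"
    and b: "\<And>i. i < j \<Longrightarrow> b i \<in> carrier_vec q"
    and b_notin: "\<And>i. i < j \<Longrightarrow> b i \<notin> V i"
    and ev: "\<And>i. i < j \<Longrightarrow> \<exists>y \<in> V i. H *\<^sub>v b i = e i \<cdot>\<^sub>v b i + y"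
    and e: "\<And>i. i < j \<Longrightarrow> s\<^sup>2 \<le> norm (e i)"
  shows "i \<le> j \<Longrightarrow> (\<forall>z \<in> carrier_vec q. \<exists>y \<in> V i. \<forall>x \<in> V i. (z - y) \<bullet>c x = 0) \<and>
      (\<forall>x \<in> V i. s\<^sup>2 * (vec_norm2 x)\<^sup>2 \<le> (vec_norm2 (A *\<^sub>v x))\<^sup>2)"
proof (induction i)
  case 0
  show ?case using V0 by (auto simp: vec_norm2_def L2_set_def)
next
  case (Suc i)
  then have ij: "i < j" by simp
  note [simp] = b[OF ij]
  have H: "H \<in> carrier_mat q q"
    unfolding H_def using A mat_adjoint_carrier[OF A] by auto
  note V_car = subsetD[OF V_carrier]
  \<comment> \<open>\<open>y0\<close> is the orthogonal projection of \<open>b i\<close> onto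
    \<open>V i\<close>; the first half of the induction claim provides it.\<close>
  obtain y0 where y0: "y0 \<in> V i" and orth: "\<And>x. x \<in> V i \<Longrightarrow> (b i - y0) \<bullet>c x = 0"
    using Suc ij by (meson b less_imp_le)
  have y0c [simp]: "y0 \<in> carrier_vec q" using V_car[OF y0] .
  have proj: "\<exists>y \<in> V i. \<forall>x \<in> V i. (z - y) \<bullet>c x = 0" if "z \<in> carrier_vec q" for z
    using Suc ij that by auto
  have bound: "s\<^sup>2 * (vec_norm2 x)\<^sup>2 \<le> (vec_norm2 (A *\<^sub>v x))\<^sup>2" if "x \<in> V i" for x
    using Suc ij that by auto
  define u where "u = b i - y0"
  have u [simp]: "u \<in> carrier_vec q" and b_u: "b i = u + y0"
    using y0c b[OF ij] unfolding u_def by (auto intro!: eq_vecI simp del: y0c b)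
  have u_orth: "u \<bullet>c x = 0" if "x \<in> V i" for x using orth[OF that] by (simp add: u_def)
  have u_orth': "x \<bullet>c u = 0" if "x \<in> V i" for x
    using u_orth[OF that] cscalar_prod_commute[OF u V_car[OF that]] by simp
  have u_nz: "u \<noteq> 0\<^sub>v q"
    using b_notin[OF ij] y0 b_u by auto
  obtain y1 where y1: "y1 \<in> V i" "H *\<^sub>v b i = e i \<cdot>\<^sub>v b i + y1" using ev[OF ij] by auto
  \<comment> \<open>Substituting \<open>b i = u + y0\<close> into the equation for \<open>H\<close>
    applied to \<open>b i\<close> leaves \<open>y2\<close> as the remainder of \<open>H u\<close>
    over \<open>e i\<close> times \<open>u\<close>.\<close>
  define y2 where "y2 = e i \<cdot>\<^sub>v y0 + y1 + (-1) \<cdot>\<^sub>v (H *\<^sub>v y0)"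
  have y2: "y2 \<in> V i"
    unfolding y2_def by (intro V_add V_smult V_H y0 y1(1))
  note [simp] = V_car[OF y1(1)] V_car[OF y2]
  have Hu: "H *\<^sub>v u = e i \<cdot>\<^sub>v u + y2"
  proof -
    have "H *\<^sub>v u + H *\<^sub>v y0 = e i \<cdot>\<^sub>v (u + y0) + y1"
      using y1(2) y0 H unfolding b_u by (subst mult_add_distrib_mat_vec[symmetric, of _ q q]) auto
    moreover have c: "H *\<^sub>v y0 \<in> carrier_vec q" "H *\<^sub>v u \<in> carrier_vec q"
      using H by auto
    moreover have "x = z - y" if "x + y = z" "x \<in> carrier_vec q" "y \<in> carrier_vec q"
      for x y z :: "'a vec"
      using that by (auto intro!: eq_vecI)
    ultimately have "H *\<^sub>v u = e i \<cdot>\<^sub>v (u + y0) + y1 - H *\<^sub>v y0" by blast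
    moreover have dims: "dim_row H = q" "dim_vec u = q" "dim_vec y0 = q" "dim_vec y1 = q"
      using H u y0c V_car[OF y1(1)] by (auto simp only: carrier_vecD carrier_matD)
    ultimately show ?thesis unfolding y2_def
      by (auto simp: algebra_simps dims simp del: index_mult_mat_vec intro!: eq_vecI)
  qed
  \<comment> \<open>The Gram identity, used in both directions, moves \<open>H\<close> from
    \<open>u\<close> onto \<open>x\<close>, and \<open>V i\<close> is invariant.\<close>
  have Hu_orth: "(H *\<^sub>v u) \<bullet>c x = 0" if x: "x \<in> V i" for x
  proof -
    have "(A *\<^sub>v x) \<bullet>c (A *\<^sub>v u) = 0"
      using u_orth'[OF V_H[OF x]] cscalar_prod_gram[OF A V_car[OF x] u] H_def by simp
    then have "(A *\<^sub>v u) \<bullet>c (A *\<^sub>v x) = 0"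
      using cscalar_prod_commute[of "A *\<^sub>v x" p "A *\<^sub>v u"] A V_car[OF x] by simp
    then show ?thesis using cscalar_prod_gram[OF A u V_car[OF x]] H_def by simp
  qed
  \<comment> \<open>\<open>y2\<close> belongs to \<open>V i\<close> and, as a combination of
    \<open>H u\<close> and \<open>u\<close>, is orthogonal to \<open>V i\<close>.\<close>
  have "y2 = 0\<^sub>v q"
  proof -
    have "y2 \<bullet>c y2 = (H *\<^sub>v u) \<bullet>c y2 - e i * (u \<bullet>c y2)"
      unfolding Hu by (simp add: cscalar_prod_add_left[of _ q] cscalar_prod_smult_left[of _ q])
    then show ?thesis using Hu_orth[OF y2] u_orth[OF y2] y2
      by (auto simp: conjugate_square_eq_0_vec[of _ q])
  qed
  then have Hu: "H *\<^sub>v u = e i \<cdot>\<^sub>v u" using Hu by auto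
  have Au: "(A *\<^sub>v u) \<bullet>c (A *\<^sub>v u) = e i * (u \<bullet>c u)"
    using cscalar_prod_gram[OF A u u] Hu unfolding H_def by simp
  \<comment> \<open>\<open>e i\<close> has not been shown to be real; taking norms in
    \<open>Au\<close> replaces it by the absolute value in which the eigenvalue bound is
    stated.\<close>
  have "(vec_norm2 (A *\<^sub>v u))\<^sup>2 = norm (e i) * (vec_norm2 u)\<^sup>2"
  proof -
    have "norm ((A *\<^sub>v u) \<bullet>c (A *\<^sub>v u)) = norm (e i * (u \<bullet>c u))" using Au by simp
    then show ?thesis by (simp add: cscalar_prod_self norm_mult norm_power vec_norm2_nonneg)
  qed
  then have bound_u: "s\<^sup>2 * (vec_norm2 u)\<^sup>2 \<le> (vec_norm2 (A *\<^sub>v u))\<^sup>2"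
    using e[OF ij] by (simp add: mult_right_mono)
  have V_Suc_u: "\<exists>a y. x = a \<cdot>\<^sub>v u + y \<and> y \<in> V i" if x: "x \<in> V (Suc i)" for x
  proof -
    obtain a y where "x = a \<cdot>\<^sub>v b i + y" "y \<in> V i" using V_Suc[OF ij] x by auto
    then have "x = a \<cdot>\<^sub>v u + (a \<cdot>\<^sub>v y0 + y)"
      using b_u V_car[OF \<open>y \<in> V i\<close>] u y0c by (auto simp: algebra_simps simp del: u y0c intro!: eq_vecI)
    moreover have "a \<cdot>\<^sub>v y0 + y \<in> V i" using y0 \<open>y \<in> V i\<close> by (intro V_add V_smult)
    ultimately have "x = a \<cdot>\<^sub>v u + (a \<cdot>\<^sub>v y0 + y)" "a \<cdot>\<^sub>v y0 + y \<in> V i" by auto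
    then show ?thesis by blast
  qed
  show ?case
  proof (intro conjI ballI)
    fix z :: "'a vec" assume z: "z \<in> carrier_vec q"
    obtain y where y: "y \<in> V i" "\<And>x. x \<in> V i \<Longrightarrow> (z - y) \<bullet>c x = 0" using proj[OF z] by auto
    define c where "c = (z \<bullet>c u) / (u \<bullet>c u)"
    have c: "c * (u \<bullet>c u) = z \<bullet>c u"
      using u_nz conjugate_square_eq_0_vec[OF u] by (simp add: c_def)
    \<comment> \<open>The projection of \<open>z\<close> is \<open>c\<close> times \<open>u\<close>
      plus \<open>y\<close>; it is written with \<open>b i\<close> so that \<open>V_Suc\<close>
      shows its membership.\<close>
    define w where "w = c \<cdot>\<^sub>v b i + (y + (- c) \<cdot>\<^sub>v y0)"
    have "y + (- c) \<cdot>\<^sub>v y0 \<in> V i" by (intro V_add V_smult y(1) y0)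
    then have w_mem: "w \<in> V (Suc i)"
      unfolding V_Suc[OF ij] w_def by blast
    have yc: "y \<in> carrier_vec q" using V_car[OF y(1)] .
    have w_eq: "w = c \<cdot>\<^sub>v u + y"
      unfolding w_def b_u using yc u y0c by (auto simp: algebra_simps simp del: u y0c intro!: eq_vecI)
    have zw: "z - w = (z - y) - c \<cdot>\<^sub>v u"
      unfolding w_eq using yc z u by (auto simp: algebra_simps simp del: u intro!: eq_vecI)
    have "(z - w) \<bullet>c x = 0" if x: "x \<in> V (Suc i)" for x
    proof -
      obtain a v where x: "x = a \<cdot>\<^sub>v u + v" "v \<in> V i" using V_Suc_u[OF x] by auto
      have v: "v \<in> carrier_vec q" "y \<in> carrier_vec q" using V_car[OF x(2)] yc by auto
      have 1: "(z - w) \<bullet>c v = 0"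
        unfolding zw using y(2)[OF x(2)] u_orth[OF x(2)] v z
        by (simp add: cscalar_prod_minus_left[of _ q] cscalar_prod_smult_left[of _ q])
      have 2: "(z - w) \<bullet>c u = 0"
        unfolding zw using c u_orth'[OF y(1)] v z
        by (simp add: cscalar_prod_minus_left[of _ q] cscalar_prod_smult_left[of _ q])
      have zwc: "z - w \<in> carrier_vec q" using z zw v by auto
      show ?thesis unfolding x(1) using 1 2 v zwc
        by (subst conjugate_add_vec[of _ q])
          (auto simp: conjugate_smult_vec scalar_prod_add_distrib[of _ q])
    qed
    then show "\<exists>y \<in> V (Suc i). \<forall>x \<in> V (Suc i). (z - y) \<bullet>c x = 0" using w_mem by blast
  next
    fix x assume "x \<in> V (Suc i)"
    then obtain a y where x: "x = a \<cdot>\<^sub>v u + y" and y: "y \<in> V i" using V_Suc_u by blast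
    have yc: "y \<in> carrier_vec q" using V_car[OF y] .
    have 1: "(vec_norm2 x)\<^sup>2 = (norm a * vec_norm2 u)\<^sup>2 + (vec_norm2 y)\<^sup>2"
      unfolding x using u_orth[OF y] yc by (subst vec_norm2_pythagoras[of _ q]) (auto simp: vec_norm2_smult)
    have Ax: "A *\<^sub>v x = a \<cdot>\<^sub>v (A *\<^sub>v u) + A *\<^sub>v y"
      unfolding x using A yc by (auto simp: mult_add_distrib_mat_vec[of _ p q] mult_mat_vec[of _ p q])
    \<comment> \<open>Orthogonality of \<open>u\<close> and \<open>y\<close> survives
      \<open>A\<close>, since \<open>H u\<close> is orthogonal to \<open>V i\<close>; so Pythagoras
      applies both before and after multiplication by \<open>A\<close>.\<close>
    have "(A *\<^sub>v u) \<bullet>c (A *\<^sub>v y) = 0"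
      using Hu_orth[OF y] cscalar_prod_gram[OF A u yc] H_def by simp
    then have 2: "(vec_norm2 (A *\<^sub>v x))\<^sup>2 = (norm a * vec_norm2 (A *\<^sub>v u))\<^sup>2 + (vec_norm2 (A *\<^sub>v y))\<^sup>2"
      unfolding Ax using A yc by (subst vec_norm2_pythagoras[of _ p]) (auto simp: vec_norm2_smult)
    have "(norm a)\<^sup>2 * (s\<^sup>2 * (vec_norm2 u)\<^sup>2) \<le> (norm a)\<^sup>2 * (vec_norm2 (A *\<^sub>v u))\<^sup>2"
      using bound_u by (simp add: mult_left_mono)
    then show "s\<^sup>2 * (vec_norm2 x)\<^sup>2 \<le> (vec_norm2 (A *\<^sub>v x))\<^sup>2"
      unfolding 1 2 using bound[OF y] by (simp add: power_mult_distrib algebra_simps)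
  qed
qed

section \<open>Spectral norm and singular values as bounds\<close>

lemma norm_vec_index_le_vec_norm2:
  assumes "i < dim_vec v"
  shows "norm (v $ i) \<le> vec_norm2 v"
  unfolding vec_norm2_def using assms by (intro member_le_L2_set) auto

lemma vec_norm2_mult_le_spectral_norm:
  fixes A :: "'a :: real_normed_field mat"
  assumes A: "A \<in> carrier_mat p q" and x: "x \<in> carrier_vec q"
  shows "vec_norm2 (A *\<^sub>v x) \<le> spectral_norm A * vec_norm2 x"
proof (cases "vec_norm2 x = 0")
  case True
  then have "x = 0\<^sub>v q" using vec_norm2_eq_0_iff[OF x] by simp
  then have "A *\<^sub>v x = 0\<^sub>v p" using A by auto
  then have "vec_norm2 (A *\<^sub>v x) = 0" using vec_norm2_eq_0_iff[of "A *\<^sub>v x" p] A by simp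
  then show ?thesis using True by simp
next
  case False
  define r where "r = vec_norm2 x"
  have r: "r > 0" using False vec_norm2_nonneg[of x] by (simp add: r_def)
  let ?U = "{v :: 'a vec. v \<in> carrier_vec (dim_col A) \<and> vec_norm2 v = 1}"
  \<comment> \<open>The supremum is an upper bound only if the values are bounded above; entries of
    a unit vector have norm at most 1, so the sum of the norms of all entries of \<open>A\<close> is
    a bound.\<close>
  have bdd: "bdd_above ((\<lambda>v. vec_norm2 (A *\<^sub>v v)) ` ?U)"
  proof (rule bdd_aboveI2)
    fix v assume v: "v \<in> ?U"
    have "vec_norm2 (A *\<^sub>v v) \<le> (\<Sum>i<p. norm ((A *\<^sub>v v) $ i))"
      unfolding vec_norm2_def using A L2_set_le_sum[of "{..<p}" "\<lambda>i. norm ((A *\<^sub>v v) $ i)"] by simp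
    also have "\<dots> \<le> (\<Sum>i<p. \<Sum>c<q. norm (A $$ (i, c)))"
    proof (rule sum_mono)
      fix i assume i: "i \<in> {..<p}"
      have "norm ((A *\<^sub>v v) $ i) = norm (\<Sum>c<q. A $$ (i, c) * v $ c)"
        using A i v by (auto simp: scalar_prod_def row_def atLeast0LessThan intro!: arg_cong[of _ _ norm] sum.cong)
      also have "\<dots> \<le> (\<Sum>c<q. norm (A $$ (i, c)))"
      proof (rule sum_norm_le)
        fix c assume "c \<in> {..<q}"
        then have "norm (v $ c) \<le> 1" using norm_vec_index_le_vec_norm2[of c v] v A by auto
        then show "norm (A $$ (i, c) * v $ c) \<le> norm (A $$ (i, c))"
          by (simp add: norm_mult mult_left_le)
      qed
      finally show "norm ((A *\<^sub>v v) $ i) \<le> (\<Sum>c<q. norm (A $$ (i, c)))" .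
    qed
    finally show "vec_norm2 (A *\<^sub>v v) \<le> (\<Sum>i<p. \<Sum>c<q. norm (A $$ (i, c)))" .
  qed
  define v where "v = of_real (inverse r) \<cdot>\<^sub>v x"
  have "v \<in> ?U"
    using x A r by (simp add: v_def vec_norm2_smult r_def[symmetric] norm_inverse)
  then have "vec_norm2 (A *\<^sub>v v) \<le> spectral_norm A"
    unfolding spectral_norm_def by (rule cSUP_upper[OF _ bdd])
  moreover have "vec_norm2 (A *\<^sub>v v) = inverse r * vec_norm2 (A *\<^sub>v x)"
    using A x r by (simp add: v_def mult_mat_vec[of _ p q] vec_norm2_smult norm_inverse)
  ultimately show ?thesis using r unfolding r_def[symmetric] by (simp add: field_simps)
qed

text \<open>One half of the Courant-Fischer principle. Schur triangularization takes the place of an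
  orthonormal eigenbasis: with the eigenvalues in decreasing order of norm on the diagonal, the
  first \<open>j\<close> columns of the similarity matrix span an invariant space for the
  \<open>j\<close> largest ones, and \<open>gram_flag_bound\<close> takes care of
  orthogonality.\<close>

lemma singular_value_attained_on_subspace:
  fixes A :: "'a :: normed_conjugatable_field mat"
  assumes A: "A \<in> carrier_mat p q" and j: "1 \<le> j" "j \<le> min p q"
    and splits: "char_poly (mat_adjoint A * A) = (\<Prod>e\<leftarrow>es0. [:- e, 1:])"
  obtains P where "P \<in> carrier_mat q j"
    and "\<And>z. z \<in> carrier_vec j \<Longrightarrow> P *\<^sub>v z = 0\<^sub>v q \<Longrightarrow> z = 0\<^sub>v j"
    and "\<And>z. z \<in> carrier_vec j \<Longrightarrow>
      singular_value j A * vec_norm2 (P *\<^sub>v z) \<le> vec_norm2 (A *\<^sub>v (P *\<^sub>v z))"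
proof -
  define H where "H = mat_adjoint A * A"
  have H: "H \<in> carrier_mat q q"
    unfolding H_def using A mat_adjoint_carrier[OF A] by auto
  define f :: "'a \<Rightarrow> real" where "f = (\<lambda>x. sqrt (norm x))"
  \<comment> \<open>Decreasing order of norm, so that position \<open>j - 1\<close> holds the
    eigenvalue behind the \<open>j\<close>th singular value and all earlier ones dominate it. The
    Schur decomposition keeps this order on its diagonal.\<close>
  define es where "es = rev (sort_key f es0)"
  have mset_es: "mset es = mset es0" by (simp add: es_def)
  have "char_poly H = (\<Prod>e\<in>#mset es. [:- e, 1:])"
    unfolding H_def splits mset_es by (metis prod_mset_prod_list mset_map)
  then have cp: "char_poly H = (\<Prod>e\<leftarrow>es. [:- e, 1:])"
    by (metis prod_mset_prod_list mset_map)
  have len: "length es = q"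
    using degree_monic_char_poly[OF H] degree_linear_factors[of uminus es] unfolding cp by simp
  have roots: "proots (char_poly H) = mset es"
  proof -
    have "proots (\<Prod>e\<leftarrow>es. [:- e, 1:]) = mset es" for es :: "'a list"
    proof (induction es)
      case (Cons a es)
      have "(\<Prod>e\<leftarrow>es. [:- e, 1:]) \<noteq> 0" for es :: "'a list"
        by (induction es) (auto simp del: mult_pCons_left)
      then show ?case using Cons.IH proots_mult[of "[:- a, 1:]"]
        by (simp del: mult_pCons_left)
    qed simp
    then show ?thesis unfolding cp by simp
  qed
  have sorted: "sorted (rev (map f es))"
    by (simp add: es_def rev_map)
  have sv: "singular_values A = take (min p q) (map f es)"
  proof -
    have "rev (sort (map f es)) = map f es"
      using sorted by (metis mset_rev properties_for_sort rev_rev_ident)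
    then show ?thesis
      using A unfolding singular_values_def H_def[symmetric] roots f_def[symmetric]
      by (simp flip: mset_map)
  qed
  define s where "s = singular_value j A"
  have s: "s = f (es ! (j - 1))"
  proof -
    have "j - 1 < min p q" "j - 1 < length es" using j len by auto
    then show ?thesis unfolding s_def singular_value_def sv by (simp only: nth_take nth_map)
  qed
  have s_nonneg: "s \<ge> 0" by (simp add: s f_def)
  have s_le: "s\<^sup>2 \<le> norm (es ! l)" if "l < j" for l
  proof -
    have "map f es ! (j - 1) \<le> map f es ! l"
      using that j len by (intro sorted_rev_nth_mono[OF sorted]) auto
    then have "s \<le> f (es ! l)" using that j len by (simp add: s)
    then have "s\<^sup>2 \<le> (f (es ! l))\<^sup>2" using s_nonneg by (simp add: power_mono)
    then show ?thesis by (simp add: f_def)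
  qed
  obtain B P Q where "schur_decomposition H es = (B, P, Q)" by (metis prod_cases3)
  from schur_decomposition[OF H cp this]
  have sim: "similar_mat_wit H B P Q" and up: "upper_triangular B" and diag: "diag_mat B = es"
    by auto
  note simD = similar_mat_witD2[OF H sim]
  note [simp] = simD(4-7)
  have dimB: "dim_row B = q" "dim_col B = q" using carrier_matD[OF simD(5)] .
  have dimP: "dim_row P = q" "dim_col P = q" using carrier_matD[OF simD(6)] .
  have HP: "H *\<^sub>v (P *\<^sub>v x) = P *\<^sub>v (B *\<^sub>v x)" if [simp]: "x \<in> carrier_vec q" for x
  proof -
    have "H * P = P * B * (Q * P)"
      by (subst simD(3)) (rule assoc_mult_mat[OF mult_carrier_mat[OF simD(6,5)] simD(7,6)])
    also have "\<dots> = P * B" unfolding simD(2) by (rule right_mult_one_mat[OF mult_carrier_mat[OF simD(6,5)]])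
    finally have "H * P = P * B" .
    then show ?thesis
      using assoc_mult_mat_vec[OF H simD(6) that] assoc_mult_mat_vec[OF simD(6,5) that] by metis
  qed
  have QP: "Q *\<^sub>v (P *\<^sub>v x) = x" if [simp]: "x \<in> carrier_vec q" for x
  proof -
    have "Q *\<^sub>v (P *\<^sub>v x) = (Q * P) *\<^sub>v x"
      by (rule assoc_mult_mat_vec[OF simD(7,6) that, symmetric])
    then show ?thesis unfolding simD(2) using one_mult_mat_vec[OF that] by simp
  qed
  have B_lower: "B $$ (k, l) = 0" if "l < k" "k < q" for k l
    using up that dimB by (auto simp: upper_triangular_def)
  have B_diag: "B $$ (l, l) = es ! l" if "l < q" for l
    using diag that dimB by (auto simp: diag_mat_def)
  \<comment> \<open>\<open>S i\<close> is spanned by the first \<open>i\<close> unit vectors and is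
    invariant under \<open>B\<close> because \<open>B\<close> is upper triangular; its image
    \<open>V i\<close> under \<open>P\<close> is invariant under \<open>H\<close>.\<close>
  define S where "S i = {x :: 'a vec. x \<in> carrier_vec q \<and> (\<forall>l<q. i \<le> l \<longrightarrow> x $ l = 0)}" for i
  define V where "V i = (\<lambda>x. P *\<^sub>v x) ` S i" for i
  define b where "b i = P *\<^sub>v unit_vec q i" for i
  have S_carrier: "x \<in> carrier_vec q" if "x \<in> S i" for x i using that by (simp add: S_def)
  have S_B: "B *\<^sub>v x \<in> S i" if x: "x \<in> S i" for x i
  proof -
    have "(B *\<^sub>v x) $ l = 0" if l: "l < q" "i \<le> l" for l
    proof -
      have "(B *\<^sub>v x) $ l = (\<Sum>r<q. B $$ (l, r) * x $ r)"
        using l S_carrier[OF x] dimB by (simp add: scalar_prod_def row_def atLeast0LessThan)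
      also have "\<dots> = 0"
      proof (rule sum.neutral, intro ballI)
        fix r assume r: "r \<in> {..<q}"
        show "B $$ (l, r) * x $ r = 0"
        proof (cases "r < l")
          case True
          then show ?thesis using B_lower l by simp
        next
          case False
          then show ?thesis using x l r by (auto simp: S_def)
        qed
      qed
      finally show ?thesis .
    qed
    then show ?thesis
      using mult_mat_vec_carrier[OF simD(5) S_carrier[OF x]] by (simp add: S_def)
  qed
  have bound: "\<forall>x \<in> V j. s\<^sup>2 * (vec_norm2 x)\<^sup>2 \<le> (vec_norm2 (A *\<^sub>v x))\<^sup>2"
  proof (rule conjunct2[OF gram_flag_bound[OF A, of V j b "\<lambda>i. es ! i" s j]])
    have "S 0 = {0\<^sub>v q}" by (auto simp: S_def intro!: eq_vecI)
    then show "V 0 = {0\<^sub>v q}"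
      by (simp add: V_def mult_zero_vec[OF simD(6)])
  next
    fix i assume i: "i < j"
    show "V (Suc i) = {a \<cdot>\<^sub>v b i + y |a y. y \<in> V i}" (is "_ = ?R")
    proof (intro equalityI subsetI)
      fix v assume "v \<in> V (Suc i)"
      then obtain x where x: "x \<in> S (Suc i)" "v = P *\<^sub>v x" by (auto simp: V_def)
      define x' where "x' = vec q (\<lambda>l. if l = i then 0 else x $ l)"
      have "x = x $ i \<cdot>\<^sub>v unit_vec q i + x'"
        using S_carrier[OF x(1)] by (auto simp: x'_def unit_vec_def intro!: eq_vecI)
      then have "v = x $ i \<cdot>\<^sub>v b i + P *\<^sub>v x'"
        unfolding x(2) b_def using mult_add_distrib_mat_vec[OF simD(6), of "x $ i \<cdot>\<^sub>v unit_vec q i" x']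
        by (simp add: mult_mat_vec[OF simD(6)] x'_def)
      moreover have "x' \<in> S i" using x(1) by (auto simp: S_def x'_def)
      ultimately show "v \<in> ?R" by (auto simp: V_def)
    next
      fix v assume "v \<in> ?R"
      then obtain a x where x: "x \<in> S i" and v: "v = a \<cdot>\<^sub>v b i + P *\<^sub>v x" by (auto simp: V_def)
      have "v = P *\<^sub>v (a \<cdot>\<^sub>v unit_vec q i + x)"
        unfolding v b_def using S_carrier[OF x]
        by (simp add: mult_add_distrib_mat_vec[OF simD(6)] mult_mat_vec[OF simD(6)])
      moreover have "a \<cdot>\<^sub>v unit_vec q i + x \<in> S (Suc i)"
        using x by (auto simp: S_def)
      ultimately show "v \<in> V (Suc i)" by (auto simp: V_def)
    qed
    show "b i \<in> carrier_vec q"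
      unfolding b_def by (rule mult_mat_vec_carrier[OF simD(6) unit_vec_carrier])
    show "b i \<notin> V i"
    proof
      assume "b i \<in> V i"
      then obtain x where x: "x \<in> S i" "P *\<^sub>v unit_vec q i = P *\<^sub>v x" by (auto simp: V_def b_def)
      then have "unit_vec q i = x" using QP S_carrier by (metis unit_vec_carrier)
      then have "unit_vec q i $ i = (0 :: 'a)" using x(1) i j by (simp add: S_def)
      then show False using i j by simp
    qed
    show "\<exists>y\<in>V i. mat_adjoint A * A *\<^sub>v b i = es ! i \<cdot>\<^sub>v b i + y"
    proof -
      \<comment> \<open>Column \<open>i\<close> of \<open>B\<close> without its diagonal entry; what
        is left lies above the diagonal, hence in \<open>S i\<close>.\<close>
      define x where "x = vec q (\<lambda>l. if l = i then 0 else B $$ (l, i))"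
      have x: "x \<in> S i" using B_lower by (auto simp: S_def x_def)
      have iq: "i < q" using i j by simp
      have "B *\<^sub>v unit_vec q i = es ! i \<cdot>\<^sub>v unit_vec q i + x"
        unfolding mult_unit_vec[OF simD(5) iq]
        using iq B_diag[OF iq] by (intro eq_vecI) (auto simp: dimB x_def)
      then have "H *\<^sub>v b i = es ! i \<cdot>\<^sub>v b i + P *\<^sub>v x"
        unfolding b_def using HP[of "unit_vec q i"] S_carrier[OF x]
        by (simp add: mult_add_distrib_mat_vec[OF simD(6)] mult_mat_vec[OF simD(6)])
      then show ?thesis using x unfolding H_def by (auto simp: V_def)
    qed
    show "s\<^sup>2 \<le> norm (es ! i)" using s_le i by simp
  next
    fix i
    show "V i \<subseteq> carrier_vec q"
      using mult_mat_vec_carrier[OF simD(6)] by (auto simp: V_def S_def)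
    fix x assume x: "x \<in> V i"
    then obtain x' where x': "x' \<in> S i" "x = P *\<^sub>v x'" by (auto simp: V_def)
    show "mat_adjoint A * A *\<^sub>v x \<in> V i"
      using HP[OF S_carrier[OF x'(1)]] S_B[OF x'(1)] x'(2) unfolding H_def V_def by auto
    fix a
    have "a \<cdot>\<^sub>v x = P *\<^sub>v (a \<cdot>\<^sub>v x')" "a \<cdot>\<^sub>v x' \<in> S i"
      using x' S_carrier[OF x'(1)] by (auto simp: mult_mat_vec[OF simD(6)] S_def)
    then show "a \<cdot>\<^sub>v x \<in> V i" by (auto simp: V_def)
    fix y assume "y \<in> V i"
    then obtain y' where y': "y' \<in> S i" "y = P *\<^sub>v y'" by (auto simp: V_def)
    have "x + y = P *\<^sub>v (x' + y')" "x' + y' \<in> S i"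
      using x' y' S_carrier[OF x'(1)] S_carrier[OF y'(1)]
      by (auto simp: mult_add_distrib_mat_vec[OF simD(6)] S_def)
    then show "x + y \<in> V i" by (auto simp: V_def)
  qed simp
  \<comment> \<open>The first \<open>j\<close> columns of \<open>P\<close>: applying
    \<open>P'\<close> to \<open>z\<close> amounts to padding \<open>z\<close> with zeros and
    applying \<open>P\<close>, which lands in \<open>V j\<close>.\<close>
  define P' where "P' = mat q j (\<lambda>(a, l). P $$ (a, l))"
  define pad where "pad z = vec q (\<lambda>l. if l < j then z $ l else 0)" for z :: "'a vec"
  have P'_pad: "P' *\<^sub>v z = P *\<^sub>v pad z" if z: "z \<in> carrier_vec j" for z
  proof (rule eq_vecI)
    fix a assume "a < dim_vec (P *\<^sub>v pad z)"
    then have a: "a < q" using dimP by simp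
    have "(P *\<^sub>v pad z) $ a = (\<Sum>l<q. if l < j then P $$ (a, l) * z $ l else 0)"
      using a dimP by (auto simp: scalar_prod_def pad_def atLeast0LessThan intro!: sum.cong)
    also have "\<dots> = (\<Sum>l<j. P $$ (a, l) * z $ l)"
      using j by (auto simp: sum.If_cases intro!: sum.cong)
    finally show "(P' *\<^sub>v z) $ a = (P *\<^sub>v pad z) $ a"
      using a z by (simp add: P'_def scalar_prod_def row_def atLeast0LessThan)
  qed (simp_all add: P'_def dimP)
  have pad_carrier [simp]: "pad z \<in> carrier_vec q" for z by (simp add: pad_def)
  show thesis
  proof (rule that)
    show "P' \<in> carrier_mat q j" by (simp add: P'_def)
    fix z :: "'a vec" assume z: "z \<in> carrier_vec j"
    show "z = 0\<^sub>v j" if "P' *\<^sub>v z = 0\<^sub>v q"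
    proof -
      have "pad z = Q *\<^sub>v 0\<^sub>v q" using that QP[of "pad z"] P'_pad[OF z] by simp
      then have 0: "pad z = 0\<^sub>v q" using mult_zero_vec[OF simD(7)] by simp
      have "z $ l = 0" if "l < j" for l
        using arg_cong[OF 0, of "\<lambda>v. v $ l"] that j by (simp add: pad_def)
      then show ?thesis using z by (auto intro!: eq_vecI)
    qed
    have "P' *\<^sub>v z \<in> V j"
      unfolding P'_pad[OF z] V_def by (auto simp: S_def pad_def)
    then have "(s * vec_norm2 (P' *\<^sub>v z))\<^sup>2 \<le> (vec_norm2 (A *\<^sub>v (P' *\<^sub>v z)))\<^sup>2"
      using bound by (simp add: power_mult_distrib)
    then show "singular_value j A * vec_norm2 (P' *\<^sub>v z) \<le> vec_norm2 (A *\<^sub>v (P' *\<^sub>v z))"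
      unfolding s_def[symmetric] by (rule power2_le_imp_le) (rule vec_norm2_nonneg)
  qed
qed

text \<open>A kernel vector \<open>x = P z\<close> of \<open>A'\<close> satisfies
  \<open>(A - A') x = A x\<close>, so the lower bound \<open>singular_value j A\<close> and the
  upper bound \<open>c\<close> collide unless \<open>x = 0\<close>. The constant \<open>c\<close> is
  kept apart from the spectral norm of \<open>A - A'\<close> because it will be
  \<open>sqrt k\<close> times the norm of the difference at index 1.\<close>

lemma singular_value_perturbation:
  fixes A :: "'a :: normed_conjugatable_field mat"
  assumes A: "A \<in> carrier_mat p q" and A': "A' \<in> carrier_mat p q"
    and j: "1 \<le> j" "j \<le> min p q"
    and splits: "\<exists>es. char_poly (mat_adjoint A * A) = (\<Prod>e\<leftarrow>es. [:- e, 1:])"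
    and near: "\<And>x. x \<in> carrier_vec q \<Longrightarrow>
      vec_norm2 ((A - A') *\<^sub>v x) \<le> c * vec_norm2 x"
    and c: "c < singular_value j A"
  obtains P where "P \<in> carrier_mat q j"
    and "\<And>z. z \<in> carrier_vec j \<Longrightarrow> A' * P *\<^sub>v z = 0\<^sub>v p \<Longrightarrow> z = 0\<^sub>v j"
proof -
  obtain P where P: "P \<in> carrier_mat q j"
    and inj: "\<And>z. z \<in> carrier_vec j \<Longrightarrow> P *\<^sub>v z = 0\<^sub>v q \<Longrightarrow> z = 0\<^sub>v j"
    and bound: "\<And>z. z \<in> carrier_vec j \<Longrightarrow>
      singular_value j A * vec_norm2 (P *\<^sub>v z) \<le> vec_norm2 (A *\<^sub>v (P *\<^sub>v z))"
    using splits singular_value_attained_on_subspace[OF A j] by blast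
  show thesis
  proof (rule that[OF P], rule inj)
    fix z assume z: "z \<in> carrier_vec j" and 0: "A' * P *\<^sub>v z = 0\<^sub>v p"
    let ?x = "P *\<^sub>v z"
    have x: "?x \<in> carrier_vec q" using P z by simp
    have "(A - A') *\<^sub>v ?x = A *\<^sub>v ?x"
      using 0 A A' P z x by (simp add: minus_mult_distrib_mat_vec[of _ p q])
    then have "singular_value j A * vec_norm2 ?x \<le> c * vec_norm2 ?x"
      using bound[OF z] near[OF x] by simp
    then have "vec_norm2 ?x = 0"
      using c vec_norm2_nonneg[of ?x] by (smt (verit) mult_less_cancel_right)
    then show "?x = 0\<^sub>v q" using vec_norm2_eq_0_iff[OF x] by simp
  qed
qed

section \<open>Splitting of the characteristic polynomial of the Gram matrix\<close>

lemma char_poly_gram_splits_complex: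
  fixes A :: "complex mat"
  assumes "A \<in> carrier_mat p q"
  shows "\<exists>es. char_poly (mat_adjoint A * A) = (\<Prod>e\<leftarrow>es. [:- e, 1:])"
  using char_poly_factorized[of "mat_adjoint A * A" q] assms mat_adjoint_carrier[OF assms] by auto

text \<open>An eigenvector \<open>v\<close> exhibits \<open>e\<close> as the quotient of the squared
  norms of \<open>A v\<close> and \<open>v\<close>.\<close>

lemma gram_eigenvalue_real:
  fixes A :: "complex mat"
  assumes A: "A \<in> carrier_mat p q" and ev: "eigenvalue (mat_adjoint A * A) e"
  shows "of_real (Re e) = e"
proof -
  obtain v where v: "v \<in> carrier_vec q" "v \<noteq> 0\<^sub>v q" "mat_adjoint A * A *\<^sub>v v = e \<cdot>\<^sub>v v"
    using ev A mat_adjoint_carrier[OF A] by (auto simp: eigenvalue_def eigenvector_def)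
  have "e * (v \<bullet>c v) = (A *\<^sub>v v) \<bullet>c (A *\<^sub>v v)"
    using cscalar_prod_gram[OF A v(1) v(1)] v by simp
  then have "e * of_real ((vec_norm2 v)\<^sup>2) = of_real ((vec_norm2 (A *\<^sub>v v))\<^sup>2)"
    by (simp only: cscalar_prod_self)
  moreover have "vec_norm2 v \<noteq> 0" using vec_norm2_eq_0_iff[OF v(1)] v(2) by simp
  ultimately have "e = of_real ((vec_norm2 (A *\<^sub>v v))\<^sup>2 / (vec_norm2 v)\<^sup>2)"
    by (simp add: field_simps)
  then show ?thesis by (metis Re_complex_of_real)
qed

text \<open>Factor over the complex numbers, where all roots are real by
  \<open>gram_eigenvalue_real\<close>, and descend: the coefficientwise embedding of real
  polynomials is injective.\<close>

lemma char_poly_gram_splits_real: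
  fixes A :: "real mat"
  assumes A: "A \<in> carrier_mat p q"
  shows "\<exists>es. char_poly (mat_adjoint A * A) = (\<Prod>e\<leftarrow>es. [:- e, 1:])"
proof -
  interpret map_poly_hom: map_poly_comm_ring_hom complex_of_real ..
  define Ac where "Ac = map_mat complex_of_real A"
  have Ac: "Ac \<in> carrier_mat p q" using A by (simp add: Ac_def)
  have adj: "mat_adjoint Ac = map_mat complex_of_real (mat_adjoint A)"
    using mat_adjoint_index[OF A] mat_adjoint_index[OF Ac] mat_adjoint_carrier[OF A]
      mat_adjoint_carrier[OF Ac] A
    by (intro eq_matI) (auto simp: Ac_def)
  have gram: "mat_adjoint Ac * Ac = map_mat complex_of_real (mat_adjoint A * A)"
    unfolding adj unfolding Ac_def
    by (rule of_real_hom.mat_hom_mult[OF mat_adjoint_carrier[OF A] A, symmetric])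
  have H: "mat_adjoint A * A \<in> carrier_mat q q" using A mat_adjoint_carrier[OF A] by auto
  have Hc: "mat_adjoint Ac * Ac \<in> carrier_mat q q" using Ac mat_adjoint_carrier[OF Ac] by auto
  obtain es where es: "char_poly (mat_adjoint Ac * Ac) = (\<Prod>e\<leftarrow>es. [:- e, 1:])"
    using char_poly_gram_splits_complex[OF Ac] by blast
  have "of_real (Re e) = e" if "e \<in> set es" for e
  proof (rule gram_eigenvalue_real[OF Ac])
    show "eigenvalue (mat_adjoint Ac * Ac) e"
      unfolding eigenvalue_root_char_poly[OF Hc] es using that by (simp add: linear_poly_root)
  qed
  then have es_Re: "es = map (\<lambda>e. of_real (Re e)) es"
    by (simp add: map_idI)
  have "map_poly complex_of_real (char_poly (mat_adjoint A * A)) = (\<Prod>e\<leftarrow>es. [:- e, 1:])"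
    using of_real_hom.char_poly_hom[OF H] gram es by metis
  also have "\<dots> = (\<Prod>e\<leftarrow>map Re es. [:- of_real e, 1:])"
    by (subst es_Re) (simp add: comp_def)
  also have "\<dots> = map_poly complex_of_real (\<Prod>e\<leftarrow>map Re es. [:- e, 1:])"
    by (simp add: map_poly_hom.hom_prod_list hom_distribs comp_def)
  finally have "char_poly (mat_adjoint A * A) = (\<Prod>e\<leftarrow>map Re es. [:- e, 1:])"
    by (auto simp: poly_eq_iff coeff_map_poly)
  then show ?thesis by blast
qed

section \<open>Trimmed Sylvester matrices\<close>

text \<open>The entry of an infinite Sylvester matrix, without bounds on \<open>r\<close> and
  \<open>c\<close> and without the cutoff at the maximal degree. All \<open>S_k\<close> are corners
  of it, so shifts can be stated independently of \<open>k\<close>.\<close>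

definition sylvester_entry :: "'a :: zero poly mat \<Rightarrow> nat \<Rightarrow> nat \<Rightarrow> 'a" where
  "sylvester_entry M r c =
     (let p = r div dim_row M; q = c div dim_col M in
      if q \<le> p then coeff (M $$ (r mod dim_row M, c mod dim_col M)) (p - q) else 0)"

text \<open>Rows keep their untrimmed numbers: \<open>r\<close> stands for the coefficient of order
  \<open>r div m\<close> in entry \<open>r mod m\<close> of the product \<open>M x\<close>, where
  \<open>m = length d\<close>.\<close>

definition sylvester_rows :: "nat list \<Rightarrow> nat \<Rightarrow> nat set" where
  "sylvester_rows d k = {r. r div length d < k + d ! (r mod length d)}"

definition sylvester_row_list :: "nat list \<Rightarrow> nat \<Rightarrow> nat list" where
  "sylvester_row_list d k =
     filter (\<lambda>r. r \<in> sylvester_rows d k) [0..<(k + Max (set d)) * length d]"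

lemma nth_le_Max_set: "i < length d \<Longrightarrow> d ! i \<le> Max (set d)"
  for d :: "nat list"
  by simp

lemma set_sylvester_row_list:
  assumes "length d > 0"
  shows "set (sylvester_row_list d k) = sylvester_rows d k"
proof -
  have "r < (k + Max (set d)) * length d" if "r \<in> sylvester_rows d k" for r
  proof -
    have "d ! (r mod length d) \<le> Max (set d)"
      by (rule nth_le_Max_set) (rule mod_less_divisor[OF assms])
    then have "r div length d < k + Max (set d)"
      using that by (simp add: sylvester_rows_def)
    then show ?thesis using assms by (simp add: div_less_iff_less_mult)
  qed
  then show ?thesis by (auto simp: sylvester_row_list_def)
qed

lemma distinct_sylvester_row_list: "distinct (sylvester_row_list d k)"
  by (simp add: sylvester_row_list_def)

lemma finite_sylvester_rows: "length d > 0 \<Longrightarrow> finite (sylvester_rows d k)"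
  by (metis List.finite_set set_sylvester_row_list)

text \<open>With \<open>r = p * m + i\<close>, the residue \<open>i\<close> admits exactly the block
  rows \<open>p < k + d ! i\<close>.\<close>

lemma card_sylvester_rows:
  assumes "length d > 0"
  shows "card (sylvester_rows d k) = k * length d + sum_list d"
proof -
  let ?m = "length d"
  have "bij_betw (\<lambda>r. (r mod ?m, r div ?m)) (sylvester_rows d k)
      (SIGMA i:{..<?m}. {..<k + d ! i})"
    by (rule bij_betw_byWitness[where f' = "\<lambda>(i, p). p * ?m + i"])
      (use assms in \<open>auto simp: sylvester_rows_def\<close>)
  then have "card (sylvester_rows d k) = card (SIGMA i:{..<?m}. {..<k + d ! i})"
    by (rule bij_betw_same_card)
  also have "\<dots> = k * ?m + sum_list d"
    by (simp add: sum.distrib sum_list_sum_nth atLeast0LessThan)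
  finally show ?thesis .
qed

lemma length_sylvester_row_list:
  assumes "length d > 0"
  shows "length (sylvester_row_list d k) = k * length d + sum_list d"
  using card_sylvester_rows[OF assms] set_sylvester_row_list[OF assms]
    distinct_card[OF distinct_sylvester_row_list] by metis

lemma row_degree_mats_coeff_eq_0:
  assumes "M \<in> row_degree_mats m n d" "i < m" "j < m + n" "d ! i < s"
  shows "coeff (M $$ (i, j)) s = 0"
  using assms by (intro coeff_eq_0) (fastforce simp: row_degree_mats_def)

lemma trimmed_sylvester_eq:
  assumes M: "M \<in> row_degree_mats m n d" and m: "m > 0" and d: "length d = m"
  shows "trimmed_sylvester d k M =
    mat (k * m + sum_list d) (k * (m + n))
      (\<lambda>(i, c). sylvester_entry M (sylvester_row_list d k ! i) c)"
proof -
  have dimM: "dim_row M = m" "dim_col M = m + n" using M by (auto simp: row_degree_mats_def)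
  let ?L = "sylvester_row_list d k" and ?D = "Max (set d)" and ?S = "sylvester d k M"
  have dimS: "dim_row ?S = (k + ?D) * m" "dim_col ?S = k * (m + n)"
    by (simp_all add: sylvester_def Let_def dimM)
  have le: "d ! (r mod m) \<le> ?D" for r using nth_le_Max_set[of "r mod m" d] m d by simp
  \<comment> \<open>On naturals, \<open>(k + ?D) - (?D - d ! i)\<close> equals
    \<open>k + d ! i\<close> because \<open>d ! i\<close> is at most \<open>?D\<close>.\<close>
  have "filter (\<lambda>r. r div m < (k + ?D) - (?D - d ! (r mod m))) [0..<dim_row ?S] = ?L"
    unfolding sylvester_row_list_def dimS d
    using le by (intro filter_cong) (auto simp: sylvester_rows_def d)
  then have T: "trimmed_sylvester d k M = mat_of_rows (k * (m + n)) (map (row ?S) ?L)"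
    by (simp add: trimmed_sylvester_def Let_def dimM dimS)
  have len: "length ?L = k * m + sum_list d" using length_sylvester_row_list[of d k] m unfolding d by blast
  \<comment> \<open>Beyond the cutoff in \<open>sylvester\<close> the coefficient vanishes by the
    row degree bounds.\<close>
  have entry: "?S $$ (r, c) = sylvester_entry M r c"
    if "r < (k + ?D) * m" "c < k * (m + n)" for r c
  proof -
    have "coeff (M $$ (r mod m, c mod (m + n))) (r div m - c div (m + n)) = 0"
      if "?D < r div m - c div (m + n)"
      using le[of r] that m by (intro row_degree_mats_coeff_eq_0[OF M]) auto
    then show ?thesis
      using that by (auto simp: sylvester_def sylvester_entry_def Let_def dimM)
  qed
  show ?thesis
  proof (rule eq_matI)
    fix i c
    assume "i < dim_row (mat (k * m + sum_list d) (k * (m + n))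
        (\<lambda>(i, c). sylvester_entry M (?L ! i) c))"
      "c < dim_col (mat (k * m + sum_list d) (k * (m + n))
        (\<lambda>(i, c). sylvester_entry M (?L ! i) c))"
    then have i: "i < k * m + sum_list d" and c: "c < k * (m + n)" by auto
    have "?L ! i < (k + ?D) * m"
    proof -
      have "?L ! i \<in> set ?L" using i len by simp
      then show ?thesis by (simp add: sylvester_row_list_def d)
    qed
    then show "trimmed_sylvester d k M $$ (i, c) =
        mat (k * m + sum_list d) (k * (m + n))
          (\<lambda>(i, c). sylvester_entry M (?L ! i) c) $$ (i, c)"
      using i c len entry dimS by (simp add: T mat_of_rows_index)
  qed (simp_all add: T len)
qed

text \<open>Here and in \<open>sylvester_surj\<close>, unknowns and right-hand sides are total
  functions of the untrimmed column and row numbers, so different \<open>k\<close> can be compared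
  without changing vector dimensions or renumbering rows.\<close>

definition sylvester_inj :: "nat list \<Rightarrow> nat \<Rightarrow> nat \<Rightarrow> 'a :: field poly mat \<Rightarrow> bool" where
  "sylvester_inj d w k M \<longleftrightarrow> (\<forall>x. (\<forall>r \<in> sylvester_rows d k.
      (\<Sum>c<k * w. sylvester_entry M r c * x c) = 0) \<longrightarrow> (\<forall>c<k * w. x c = 0))"

definition sylvester_surj :: "nat list \<Rightarrow> nat \<Rightarrow> nat \<Rightarrow> 'a :: field poly mat \<Rightarrow> bool" where
  "sylvester_surj d w k M \<longleftrightarrow> (\<forall>b. \<exists>x. \<forall>r \<in> sylvester_rows d k.
      (\<Sum>c<k * w. sylvester_entry M r c * x c) = b r)"

lemma sum_lessThan_add: "(\<Sum>c<a + b. f c) = (\<Sum>c<a. f c) + (\<Sum>c<b. f (a + c))"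
  for f :: "nat \<Rightarrow> 'a :: comm_monoid_add"
  by (induction b) (simp_all add: add.assoc)

lemma sum_lessThan_mult: "(\<Sum>c<k * w. f c) = (\<Sum>q<k. \<Sum>j<w. f (q * w + j))"
  for f :: "nat \<Rightarrow> 'a :: comm_monoid_add"
proof (induction k)
  case (Suc k)
  then show ?case using sum_lessThan_add[of f "k * w" w] by (simp add: add.commute)
qed simp

section \<open>Passing injectivity down and surjectivity up in \<open>k\<close>\<close>

context
  fixes m n :: nat and d :: "nat list"
  assumes m_pos: "m > 0" and length_d: "length d = m"
begin

lemma trimmed_sylvester_carrier:
  "M \<in> row_degree_mats m n d \<Longrightarrow>
    trimmed_sylvester d k M \<in> carrier_mat (k * m + sum_list d) (k * (m + n))"
  by (simp add: trimmed_sylvester_eq[OF _ m_pos length_d])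

lemma sylvester_row_list_bij:
  "bij_betw (\<lambda>i. sylvester_row_list d k ! i) {..<k * m + sum_list d} (sylvester_rows d k)"
proof -
  have "length d > 0" using m_pos length_d by simp
  note length_sylvester_row_list[OF this, of k] set_sylvester_row_list[OF this, of k]
  then show ?thesis
    using bij_betw_nth[OF distinct_sylvester_row_list refl refl, of d k] length_d by simp
qed

lemma trimmed_sylvester_mult_vec_index:
  assumes "M \<in> row_degree_mats m n d" "x \<in> carrier_vec (k * (m + n))" "i < k * m + sum_list d"
  shows "(trimmed_sylvester d k M *\<^sub>v x) $ i =
    (\<Sum>c<k * (m + n). sylvester_entry M (sylvester_row_list d k ! i) c * x $ c)"
  using assms
  by (simp add: trimmed_sylvester_eq[OF _ m_pos length_d] scalar_prod_def row_def atLeast0LessThan)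

text \<open>In column block \<open>q < k\<close>, row \<open>i\<close> of \<open>M\<close> reaches
  block rows up to \<open>q + d ! i\<close> only. As \<open>r\<close> is arbitrary, this also shows
  that the extra rows of a longer trimmed matrix vanish on the first \<open>k\<close> column
  blocks.\<close>

lemma sylvester_entry_eq_0:
  assumes M: "M \<in> row_degree_mats m n d" and r: "r \<notin> sylvester_rows d k" and c: "c < k * (m + n)"
  shows "sylvester_entry M r c = 0"
proof -
  have dimM: "dim_row M = m" "dim_col M = m + n" using M by (auto simp: row_degree_mats_def)
  have "c div (m + n) < k" using c by (simp add: less_mult_imp_div_less)
  then have "d ! (r mod m) < r div m - c div (m + n)"
    using r length_d by (auto simp: sylvester_rows_def)
  then show ?thesis
    using row_degree_mats_coeff_eq_0[OF M, of "r mod m" "c mod (m + n)"] m_pos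
    by (simp add: sylvester_entry_def Let_def dimM)
qed

text \<open>Toeplitz structure: moving right by \<open>q\<close> block columns is moving down by
  \<open>q\<close> block rows, that is, multiplication by the \<open>q\<close>th power of the
  indeterminate.\<close>

lemma sylvester_entry_shift:
  assumes M: "M \<in> row_degree_mats m n d"
  shows "sylvester_entry M r (q * (m + n) + c) =
    (if q * m \<le> r then sylvester_entry M (r - q * m) c else 0)"
proof -
  have dimM: "dim_row M = m" "dim_col M = m + n" using M by (auto simp: row_degree_mats_def)
  have c: "(q * (m + n) + c) div (m + n) = q + c div (m + n)"
    "(q * (m + n) + c) mod (m + n) = c mod (m + n)"
    using m_pos by simp_all
  show ?thesis
  proof (cases "q * m \<le> r")
    case True
    then obtain s where r: "r = q * m + s" using le_Suc_ex by blast
    have "(q * m + s) div m = q + s div m" "(q * m + s) mod m = s mod m" using m_pos by simp_all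
    then show ?thesis
      unfolding sylvester_entry_def Let_def dimM c r by simp
  next
    case False
    then have "r div m < q" using m_pos by (simp add: div_less_iff_less_mult)
    then show ?thesis using False unfolding sylvester_entry_def Let_def dimM c by simp
  qed
qed

lemma sum_sylvester_extend:
  fixes f g :: "nat \<Rightarrow> 'a :: field"
  shows "(\<Sum>c<Suc k * w. f c * (if c < k * w then g c else 0)) = (\<Sum>c<k * w. f c * g c)"
proof -
  have "(\<Sum>c<Suc k * w. f c * (if c < k * w then g c else 0)) =
      (\<Sum>c<Suc k * w. if c < k * w then f c * g c else 0)"
    by (intro sum.cong) auto
  also have "\<dots> = (\<Sum>c \<in> {..<Suc k * w} \<inter> {c. c < k * w}. f c * g c)"
    by (simp add: sum.If_cases)
  also have "{..<Suc k * w} \<inter> {c. c < k * w} = {..<k * w}" by auto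
  finally show ?thesis .
qed

text \<open>A kernel vector stays one when padded with a zero block: the rows of index
  \<open>k\<close> see no change and all other rows vanish on the old columns.\<close>

lemma sylvester_inj_SucD:
  assumes M: "M \<in> row_degree_mats m n d" and inj: "sylvester_inj d (m + n) (Suc k) M"
  shows "sylvester_inj d (m + n) k M"
  unfolding sylvester_inj_def
proof (intro allI impI)
  fix x c
  assume x: "\<forall>r \<in> sylvester_rows d k. (\<Sum>c<k * (m + n). sylvester_entry M r c * x c) = 0"
    and c: "c < k * (m + n)"
  let ?y = "\<lambda>c. if c < k * (m + n) then x c else 0"
  have "(\<Sum>c<Suc k * (m + n). sylvester_entry M r c * ?y c) = 0" for r
  proof (cases "r \<in> sylvester_rows d k")
    case True
    then show ?thesis using x unfolding sum_sylvester_extend by blast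
  next
    case False
    then show ?thesis unfolding sum_sylvester_extend using sylvester_entry_eq_0[OF M] by simp
  qed
  then have "?y c = 0"
    using inj[unfolded sylvester_inj_def, rule_format, of ?y c] c by simp
  then show "x c = 0" using c by simp
qed

lemma sylvester_inj_antimono:
  assumes M: "M \<in> row_degree_mats m n d" and "sylvester_inj d (m + n) k' M" "k \<le> k'"
  shows "sylvester_inj d (m + n) k M"
  using assms(3,2) by (induction rule: inc_induct) (auto intro: sylvester_inj_SucD[OF M])

text \<open>
  In terms of polynomials: a vector whose \<open>i\<close>th entry has degree at most \<open>k + d ! i\<close> is \<open>\<lambda>\<close> times
  a vector with these bounds lowered by one, plus another such vector, as \<open>k + d ! i \<ge> 1\<close>.
\<close>

lemma sylvester_surj_Suc:
  assumes M: "M \<in> row_degree_mats m n d" and k: "k \<ge> 1" and surj: "sylvester_surj d (m + n) k M"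
  shows "sylvester_surj d (m + n) (Suc k) M"
  unfolding sylvester_surj_def
proof
  fix b :: "nat \<Rightarrow> 'a"
  let ?w = "m + n" and ?R = "sylvester_rows d"
  define lin where "lin k x r = (\<Sum>c<k * ?w. sylvester_entry M r c * x c)"
    for k x r
  have solve: "\<exists>x. \<forall>r \<in> ?R k. lin k x r = b r" for b
    using surj unfolding sylvester_surj_def lin_def by blast
  \<comment> \<open>\<open>x2\<close> solves for the right-hand side moved up by one block row; its
    shift \<open>x2'\<close> is the product with the indeterminate.\<close>
  obtain x2 where x2: "\<And>r. r \<in> ?R k \<Longrightarrow> lin k x2 r = b (r + m)"
    using solve[of "\<lambda>r. b (r + m)"] by auto
  define x2' where "x2' c = (if c < ?w then 0 else x2 (c - ?w))" for c
  have lin_x2': "lin (Suc k) x2' (r + m) = lin k x2 r" for r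
  proof -
    have "lin (Suc k) x2' (r + m) =
        (\<Sum>c<?w + k * ?w. sylvester_entry M (r + m) c * x2' c)"
      by (simp add: lin_def)
    also have "\<dots> = (\<Sum>c<?w. sylvester_entry M (r + m) c * x2' c)
        + (\<Sum>c<k * ?w. sylvester_entry M (r + m) (?w + c) * x2' (?w + c))"
      by (rule sum_lessThan_add)
    also have "\<dots> = lin k x2 r"
      using sylvester_entry_shift[OF M, of "r + m" 1] by (simp add: lin_def x2'_def)
    finally show ?thesis .
  qed
  \<comment> \<open>\<open>x1\<close> corrects the error of \<open>x2'\<close> on
    \<open>?R k\<close>; on the remaining rows it contributes nothing, and there \<open>x2'\<close>
    is already exact.\<close>
  obtain x1 where x1: "\<And>r. r \<in> ?R k \<Longrightarrow> lin k x1 r = b r - lin (Suc k) x2' r"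
    using solve[of "\<lambda>r. b r - lin (Suc k) x2' r"] by auto
  define x where "x c = (if c < k * ?w then x1 c else 0) + x2' c" for c
  have x: "lin (Suc k) x r = lin k x1 r + lin (Suc k) x2' r" for r
    unfolding lin_def x_def distrib_left[of "sylvester_entry M r _"] sum.distrib sum_sylvester_extend ..
  have "lin (Suc k) x r = b r" if r: "r \<in> ?R (Suc k)" for r
  proof (cases "r \<in> ?R k")
    case True
    then show ?thesis using x x1 by simp
  next
    case False
    \<comment> \<open>Outside \<open>?R k\<close> the block index is at least \<open>k\<close>,
      hence positive, so the row one block above exists.\<close>
    then have "r div m \<ge> 1" using k length_d by (simp add: sylvester_rows_def)
    then have "m \<le> r" using m_pos by (metis div_less not_less not_one_le_zero)
    then obtain s where s: "r = s + m" by (metis le_add_diff_inverse2)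
    have "s \<in> ?R k" using r m_pos length_d by (simp add: s sylvester_rows_def)
    then have "lin (Suc k) x2' r = b r" using lin_x2' x2 s by simp
    moreover have "lin k x1 r = 0"
      unfolding lin_def using sylvester_entry_eq_0[OF M False] by simp
    ultimately show ?thesis using x by simp
  qed
  then show "\<exists>x. \<forall>r \<in> ?R (Suc k). (\<Sum>c<Suc k * ?w. sylvester_entry M r c * x c) = b r"
    unfolding lin_def by blast
qed

lemma sylvester_surj_mono:
  assumes M: "M \<in> row_degree_mats m n d" and "sylvester_surj d (m + n) k' M" "1 \<le> k'" "k' \<le> k"
  shows "sylvester_surj d (m + n) k M"
  using assms(4,2) \<open>1 \<le> k'\<close> by (induction rule: dec_induct) (auto intro: sylvester_surj_Suc[OF M])

end

section \<open>Bounding the trimmed matrix of index \<open>k\<close> by that of index 1\<close>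

lemma sum_abs_le_sqrt_L2_set:
  fixes f :: "nat \<Rightarrow> real"
  shows "(\<Sum>q<k. \<bar>f q\<bar>) \<le> sqrt (real k) * L2_set f {..<k}"
  using L2_set_mult_ineq[of "\<lambda>_. 1" f "{..<k}"] by (simp add: L2_set_def)

lemma L2_set_norm_sum_le:
  fixes f :: "'i \<Rightarrow> nat \<Rightarrow> 'a :: real_normed_vector"
  shows "L2_set (\<lambda>i. norm (\<Sum>j<k. f i j)) I \<le> (\<Sum>j<k. L2_set (\<lambda>i. norm (f i j)) I)"
proof (induction k)
  case 0
  show ?case by (simp add: L2_set_def)
next
  case (Suc k)
  have "L2_set (\<lambda>i. norm (\<Sum>j<Suc k. f i j)) I \<le>
      L2_set (\<lambda>i. norm (\<Sum>j<k. f i j) + norm (f i k)) I"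
    by (intro L2_set_mono) (auto intro: norm_triangle_ineq)
  also have "\<dots> \<le> L2_set (\<lambda>i. norm (\<Sum>j<k. f i j)) I + L2_set (\<lambda>i. norm (f i k)) I"
    by (rule L2_set_triangle_ineq)
  finally show ?case using Suc by simp
qed

context
  fixes m n :: nat and d :: "nat list"
  assumes m_pos: "m > 0" and length_d: "length d = m"
begin

lemma vec_norm2_trimmed_sylvester_mult:
  fixes M :: "'a :: real_normed_field poly mat"
  assumes M: "M \<in> row_degree_mats m n d" and x: "x \<in> carrier_vec (k * (m + n))"
  shows "vec_norm2 (trimmed_sylvester d k M *\<^sub>v x) =
    L2_set (\<lambda>r. norm (\<Sum>c<k * (m + n). sylvester_entry M r c * x $ c)) (sylvester_rows d k)"
proof -
  let ?L = "sylvester_row_list d k"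
  let ?f = "\<lambda>r. (norm (\<Sum>c<k * (m + n). sylvester_entry M r c * x $ c))\<^sup>2"
  have dim: "dim_vec (trimmed_sylvester d k M *\<^sub>v x) = k * m + sum_list d"
    using trimmed_sylvester_carrier[OF m_pos length_d M, of k] by simp
  have "(\<Sum>i<k * m + sum_list d. (norm ((trimmed_sylvester d k M *\<^sub>v x) $ i))\<^sup>2)
      = (\<Sum>i<k * m + sum_list d. ?f (?L ! i))"
    using trimmed_sylvester_mult_vec_index[OF m_pos length_d M x] by (intro sum.cong) auto
  also have "\<dots> = sum ?f (sylvester_rows d k)"
    by (rule sum.reindex_bij_betw[OF sylvester_row_list_bij[OF m_pos length_d]])
  finally show ?thesis unfolding vec_norm2_def L2_set_def dim by simp
qed

lemma trimmed_sylvester_norm_bound: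
  fixes M :: "'a :: real_normed_field poly mat"
  assumes M: "M \<in> row_degree_mats m n d" and x: "x \<in> carrier_vec (k * (m + n))"
  shows "vec_norm2 (trimmed_sylvester d k M *\<^sub>v x) \<le>
    sqrt (real k) * spectral_norm (trimmed_sylvester d 1 M) * vec_norm2 x"
proof -
  let ?w = "m + n" and ?R = "sylvester_rows d"
  let ?N = "spectral_norm (trimmed_sylvester d 1 M)"
  define lin where "lin q r = (\<Sum>j<?w. sylvester_entry M r j * x $ (q * ?w + j))" for q r
  define X where "X q = vec ?w (\<lambda>j. x $ (q * ?w + j))" for q
  have T: "trimmed_sylvester d 1 M \<in> carrier_mat (1 * m + sum_list d) (1 * ?w)"
    by (rule trimmed_sylvester_carrier[OF m_pos length_d M])
  have X: "X q \<in> carrier_vec (1 * ?w)" for q by (simp add: X_def)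
  have N: "vec_norm2 (trimmed_sylvester d 1 M *\<^sub>v v) \<le> ?N * vec_norm2 v"
    if "v \<in> carrier_vec (1 * ?w)" for v
    using vec_norm2_mult_le_spectral_norm[OF T that] .
  \<comment> \<open>Needed to multiply the Cauchy-Schwarz inequality by \<open>?N\<close>. A unit
    vector exists because \<open>m + n > 0\<close>, and its image has nonnegative norm.\<close>
  have N_nonneg: "?N \<ge> 0"
  proof -
    let ?u = "unit_vec ?w 0 :: 'a vec"
    have "vec_norm2 ?u \<noteq> 0"
    proof
      assume "vec_norm2 ?u = 0"
      then have "?u = 0\<^sub>v ?w" using vec_norm2_eq_0_iff[of ?u ?w] by simp
      then have "?u $ 0 = 0\<^sub>v ?w $ 0" by simp
      then show False using m_pos by simp
    qed
    then have "vec_norm2 ?u > 0" using vec_norm2_nonneg[of ?u] by simp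
    moreover have "0 \<le> ?N * vec_norm2 ?u"
      using N[of ?u] vec_norm2_nonneg[of "trimmed_sylvester d 1 M *\<^sub>v ?u"] by simp
    ultimately show ?thesis by (simp add: zero_le_mult_iff)
  qed
  have split: "(\<Sum>c<k * ?w. sylvester_entry M r c * x $ c) =
      (\<Sum>q<k. if q * m \<le> r then lin q (r - q * m) else 0)" for r
    unfolding sum_lessThan_mult
    by (intro sum.cong refl) (simp add: sylvester_entry_shift[OF m_pos length_d M] lin_def)
  have lin_0: "lin q r = 0" if "r \<notin> ?R 1" for q r
    unfolding lin_def using sylvester_entry_eq_0[OF m_pos length_d M that] by simp
  have fin: "finite (?R k)" for k using finite_sylvester_rows m_pos length_d by blast
  \<comment> \<open>The rows that contribute are those of the form \<open>s + q * m\<close> with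
    \<open>s\<close> in \<open>?R 1\<close>; all others vanish, so a shifted copy is no longer than
    the original product.\<close>
  have block: "L2_set (\<lambda>r. norm (if q * m \<le> r then lin q (r - q * m) else 0)) (?R k)
      \<le> L2_set (\<lambda>r. norm (lin q r)) (?R 1)" for q
    unfolding L2_set_def
  proof (rule real_sqrt_le_mono)
    let ?f = "\<lambda>r. (norm (if q * m \<le> r then lin q (r - q * m) else 0))\<^sup>2"
    let ?S = "{r \<in> ?R k. q * m \<le> r \<and> r - q * m \<in> ?R 1}"
    have "sum ?f (?R k) = sum ?f ?S"
      using fin lin_0 by (intro sum.mono_neutral_right) auto
    also have "\<dots> \<le> (\<Sum>r \<in> ?R 1. (norm (lin q r))\<^sup>2)"
    proof (rule sum_le_included[where i = "\<lambda>r. r + q * m"])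
      show "\<forall>r \<in> ?S. \<exists>s \<in> ?R 1. s + q * m = r \<and> ?f r \<le> (norm (lin q s))\<^sup>2"
      proof
        fix r assume "r \<in> ?S"
        then show "\<exists>s \<in> ?R 1. s + q * m = r \<and> ?f r \<le> (norm (lin q s))\<^sup>2"
          by (intro bexI[of _ "r - q * m"]) auto
      qed
    qed (use fin in auto)
    finally show "sum ?f (?R k) \<le> (\<Sum>r \<in> ?R 1. (norm (lin q r))\<^sup>2)" .
  qed
  have "vec_norm2 (trimmed_sylvester d k M *\<^sub>v x) =
      L2_set (\<lambda>r. norm (\<Sum>q<k. if q * m \<le> r then lin q (r - q * m) else 0)) (?R k)"
    unfolding vec_norm2_trimmed_sylvester_mult[OF M x] split ..
  also have "\<dots> \<le> (\<Sum>q<k. L2_set (\<lambda>r. norm (if q * m \<le> r then lin q (r - q * m) else 0)) (?R k))"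
    by (rule L2_set_norm_sum_le)
  also have "\<dots> \<le> (\<Sum>q<k. L2_set (\<lambda>r. norm (lin q r)) (?R 1))"
    by (intro sum_mono block)
  also have "\<dots> = (\<Sum>q<k. vec_norm2 (trimmed_sylvester d 1 M *\<^sub>v X q))"
    unfolding vec_norm2_trimmed_sylvester_mult[OF M X] by (simp add: lin_def X_def)
  also have "\<dots> \<le> (\<Sum>q<k. ?N * vec_norm2 (X q))"
    by (intro sum_mono N X)
  also have "\<dots> = ?N * (\<Sum>q<k. \<bar>vec_norm2 (X q)\<bar>)"
    by (simp add: sum_distrib_left vec_norm2_nonneg)
  also have "\<dots> \<le> ?N * (sqrt (real k) * L2_set (\<lambda>q. vec_norm2 (X q)) {..<k})"
    by (intro mult_left_mono sum_abs_le_sqrt_L2_set N_nonneg)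
  \<comment> \<open>The blocks \<open>X q\<close> partition the entries of \<open>x\<close>.\<close>
  also have "L2_set (\<lambda>q. vec_norm2 (X q)) {..<k} = vec_norm2 x"
    using x unfolding vec_norm2_def[of x] L2_set_def vec_norm2_squared
    by (simp add: X_def sum_lessThan_mult[of _ k ?w])
  finally show ?thesis by (simp add: mult_ac)
qed

section \<open>Linearity in \<open>M\<close>, and the passage from row equations to matrices and
  rank\<close>

lemma trimmed_sylvester_minus:
  fixes M M' :: "'a :: real_normed_field poly mat"
  assumes M: "M \<in> row_degree_mats m n d" and M': "M' \<in> row_degree_mats m n d"
  shows "M - M' \<in> row_degree_mats m n d"
    and "trimmed_sylvester d k (M - M') = trimmed_sylvester d k M - trimmed_sylvester d k M'"
proof -
  have dims: "M \<in> carrier_mat m (m + n)" "M' \<in> carrier_mat m (m + n)"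
    using M M' by (simp_all add: row_degree_mats_def)
  then show diff: "M - M' \<in> row_degree_mats m n d"
    using M M' by (auto simp: row_degree_mats_def intro: degree_diff_le)
  have "sylvester_entry (M - M') r c = sylvester_entry M r c - sylvester_entry M' r c" for r c
    using dims m_pos by (simp add: sylvester_entry_def Let_def)
  then show "trimmed_sylvester d k (M - M') = trimmed_sylvester d k M - trimmed_sylvester d k M'"
    unfolding trimmed_sylvester_eq[OF M m_pos length_d] trimmed_sylvester_eq[OF M' m_pos length_d]
      trimmed_sylvester_eq[OF diff m_pos length_d]
    by (intro eq_matI) auto
qed

lemma trimmed_sylvester_mult_vec_eq_iff:
  assumes M: "M \<in> row_degree_mats m n d"
  shows "trimmed_sylvester d k M *\<^sub>v vec (k * (m + n)) x =
      vec (k * m + sum_list d) (\<lambda>i. b (sylvester_row_list d k ! i)) \<longleftrightarrow>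
    (\<forall>r \<in> sylvester_rows d k. (\<Sum>c<k * (m + n). sylvester_entry M r c * x c) = b r)"
    (is "?T *\<^sub>v ?x = ?b \<longleftrightarrow> (\<forall>r \<in> ?R. ?lin r = b r)")
proof -
  let ?L = "sylvester_row_list d k"
  have "dim_row ?T = k * m + sum_list d"
    using trimmed_sylvester_carrier[OF m_pos length_d M, of k] by simp
  then have "?T *\<^sub>v ?x = ?b \<longleftrightarrow> (\<forall>i<k * m + sum_list d. (?T *\<^sub>v ?x) $ i = b (?L ! i))"
    by (auto simp: vec_eq_iff)
  also have "\<dots> \<longleftrightarrow> (\<forall>i \<in> {..<k * m + sum_list d}. ?lin (?L ! i) = b (?L ! i))"
    using trimmed_sylvester_mult_vec_index[OF m_pos length_d M, of ?x k] by auto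
  also have "\<dots> \<longleftrightarrow> (\<forall>r \<in> (\<lambda>i. ?L ! i) ` {..<k * m + sum_list d}. ?lin r = b r)"
    by blast
  also have "(\<lambda>i. ?L ! i) ` {..<k * m + sum_list d} = ?R"
    using sylvester_row_list_bij[OF m_pos length_d] by (rule bij_betw_imp_surj_on)
  finally show ?thesis .
qed

lemma sylvester_inj_iff:
  assumes M: "M \<in> row_degree_mats m n d"
  shows "sylvester_inj d (m + n) k M \<longleftrightarrow> (\<forall>v \<in> carrier_vec (k * (m + n)).
    trimmed_sylvester d k M *\<^sub>v v = 0\<^sub>v (k * m + sum_list d) \<longrightarrow> v = 0\<^sub>v (k * (m + n)))"
proof -
  note iff = trimmed_sylvester_mult_vec_eq_iff[OF M, of k _ "\<lambda>_. 0", folded zero_vec_def, symmetric]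
  have vec0: "(\<forall>c<k * (m + n). x c = 0) \<longleftrightarrow> vec (k * (m + n)) x = 0\<^sub>v (k * (m + n))"
    for x :: "nat \<Rightarrow> 'a"
    by (auto simp: vec_eq_iff)
  have "(\<forall>x. P (vec q x)) \<longleftrightarrow> (\<forall>v \<in> carrier_vec q. P v)" for P :: "'a vec \<Rightarrow> bool" and q
    by (metis carrier_vecD eq_vecI vec_carrier dim_vec index_vec)
  then show ?thesis
    unfolding sylvester_inj_def iff vec0 .
qed

lemma sylvester_surj_iff:
  assumes M: "M \<in> row_degree_mats m n d"
  shows "sylvester_surj d (m + n) k M \<longleftrightarrow> (\<forall>b \<in> carrier_vec (k * m + sum_list d).
    \<exists>v \<in> carrier_vec (k * (m + n)). trimmed_sylvester d k M *\<^sub>v v = b)"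
proof -
  let ?L = "sylvester_row_list d k" and ?p = "k * m + sum_list d"
  note iff = trimmed_sylvester_mult_vec_eq_iff[OF M, of k, symmetric]
  have ex: "(\<exists>x. P (vec q x)) \<longleftrightarrow> (\<exists>v \<in> carrier_vec q. P v)" for P :: "'a vec \<Rightarrow> bool" and q
    by (metis carrier_vecD eq_vecI vec_carrier dim_vec index_vec)
  have "\<exists>b. v = vec ?p (\<lambda>i. b (?L ! i))" if "v \<in> carrier_vec ?p" for v :: "'a vec"
  proof
    \<comment> \<open>Inverting the enumeration of the surviving rows turns a vector into a function
      of row numbers; its values at other rows do not matter.\<close>
    let ?b = "\<lambda>r. v $ the_inv_into {..<?p} (\<lambda>i. ?L ! i) r"
    have "inj_on (\<lambda>i. ?L ! i) {..<?p}"
      using sylvester_row_list_bij[OF m_pos length_d] by (rule bij_betw_imp_inj_on)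
    then show "v = vec ?p (\<lambda>i. ?b (?L ! i))"
      using that by (auto simp: the_inv_into_f_f)
  qed
  then have all: "(\<forall>b. P (vec ?p (\<lambda>i. b (?L ! i)))) \<longleftrightarrow> (\<forall>v \<in> carrier_vec ?p. P v)"
    for P :: "'a vec \<Rightarrow> bool"
    by (metis vec_carrier)
  show ?thesis
    unfolding sylvester_surj_def iff ex[of "\<lambda>v. trimmed_sylvester d k M *\<^sub>v v = _"]
    by (rule all[of "\<lambda>b. \<exists>v \<in> _. _ v = b"])
qed

lemma rank_ge_if_sylvester_inj:
  assumes M: "M \<in> row_degree_mats m n d" and inj: "sylvester_inj d (m + n) k M"
  shows "k * (m + n) \<le> vec_space.rank (k * m + sum_list d) (trimmed_sylvester d k M)"
proof -
  note T = trimmed_sylvester_carrier[OF m_pos length_d M, of k]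
  show ?thesis
    using inj by (intro vec_space_rank_ge[OF T one_carrier_mat])
      (simp add: right_mult_one_mat[OF T] sylvester_inj_iff[OF M])
qed

lemma rank_ge_if_sylvester_surj:
  assumes M: "M \<in> row_degree_mats m n d" and surj: "sylvester_surj d (m + n) k M"
  shows "k * m + sum_list d \<le> vec_space.rank (k * m + sum_list d) (trimmed_sylvester d k M)"
proof -
  let ?p = "k * m + sum_list d" and ?q = "k * (m + n)"
  note T = trimmed_sylvester_carrier[OF m_pos length_d M, of k]
  have "\<exists>v \<in> carrier_vec ?q. trimmed_sylvester d k M *\<^sub>v v = unit_vec ?p i" for i
    using surj unfolding sylvester_surj_iff[OF M] by simp
  then obtain X where X: "\<And>i. X i \<in> carrier_vec ?q"
    "\<And>i. trimmed_sylvester d k M *\<^sub>v X i = unit_vec ?p i" by metis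
  \<comment> \<open>Preimages of the unit vectors as columns give a right inverse.\<close>
  define P where "P = mat_of_cols ?q (map X [0..<?p])"
  have P: "P \<in> carrier_mat ?q ?p" unfolding P_def by (rule carrier_matI) simp_all
  have "trimmed_sylvester d k M * P = 1\<^sub>m ?p"
  proof (rule mat_col_eqI)
    fix i assume "i < dim_col (1\<^sub>m ?p :: 'a mat)"
    then have i: "i < ?p" by simp
    have "col (trimmed_sylvester d k M * P) i = trimmed_sylvester d k M *\<^sub>v col P i"
      using T P i by (rule col_mult2)
    also have "col P i = X i" using i X by (simp add: P_def)
    finally show "col (trimmed_sylvester d k M * P) i = col (1\<^sub>m ?p) i" using X i by simp
  qed (use T P in auto)
  then show ?thesis by (intro vec_space_rank_ge[OF T P]) simp
qed

text \<open>The case of a singular value index equal to the number of columns: \<open>P\<close> is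
  square and injective, hence onto, so injectivity of the product passes to the trimmed matrix
  itself.\<close>

lemma sylvester_inj_if_mult_inj:
  assumes M: "M \<in> row_degree_mats m n d"
    and P: "P \<in> carrier_mat (k * (m + n)) (k * (m + n))"
    and inj: "\<And>z. z \<in> carrier_vec (k * (m + n)) \<Longrightarrow>
      trimmed_sylvester d k M * P *\<^sub>v z = 0\<^sub>v (k * m + sum_list d) \<Longrightarrow> z = 0\<^sub>v (k * (m + n))"
  shows "sylvester_inj d (m + n) k M"
  unfolding sylvester_inj_iff[OF M]
proof (intro ballI impI)
  note T = trimmed_sylvester_carrier[OF m_pos length_d M, of k]
  fix v :: "'a vec" assume v: "v \<in> carrier_vec (k * (m + n))"
    and Tv: "trimmed_sylvester d k M *\<^sub>v v = 0\<^sub>v (k * m + sum_list d)"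
  have "z = 0\<^sub>v (k * (m + n))"
    if "z \<in> carrier_vec (k * (m + n))" "P *\<^sub>v z = 0\<^sub>v (k * (m + n))" for z
    using inj[OF that(1)] that assoc_mult_mat_vec[OF T P that(1)] mult_zero_vec[OF T] by simp
  then obtain z where z: "z \<in> carrier_vec (k * (m + n))" "P *\<^sub>v z = v"
    using mult_mat_vec_inj_imp_surj[OF P _ v] by blast
  then have "z = 0\<^sub>v (k * (m + n))"
    using inj[OF z(1)] assoc_mult_mat_vec[OF T P z(1)] Tv by simp
  then show "v = 0\<^sub>v (k * (m + n))" using z(2) mult_zero_vec[OF P] by simp
qed

text \<open>The case of a singular value index equal to the number of rows: the product with
  \<open>P\<close> is square and injective, hence onto.\<close>

lemma sylvester_surj_if_mult_inj:
  assumes M: "M \<in> row_degree_mats m n d"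
    and P: "P \<in> carrier_mat (k * (m + n)) (k * m + sum_list d)"
    and inj: "\<And>z. z \<in> carrier_vec (k * m + sum_list d) \<Longrightarrow>
      trimmed_sylvester d k M * P *\<^sub>v z = 0\<^sub>v (k * m + sum_list d) \<Longrightarrow> z = 0\<^sub>v (k * m + sum_list d)"
  shows "sylvester_surj d (m + n) k M"
  unfolding sylvester_surj_iff[OF M]
proof
  note T = trimmed_sylvester_carrier[OF m_pos length_d M, of k]
  fix b :: "'a vec" assume b: "b \<in> carrier_vec (k * m + sum_list d)"
  obtain z where z: "z \<in> carrier_vec (k * m + sum_list d)" "trimmed_sylvester d k M * P *\<^sub>v z = b"
    using mult_mat_vec_inj_imp_surj[OF mult_carrier_mat[OF T P] inj b] by blast
  then show "\<exists>v \<in> carrier_vec (k * (m + n)). trimmed_sylvester d k M *\<^sub>v v = b"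
    using assoc_mult_mat_vec[OF T P z(1)] mult_mat_vec_carrier[OF P z(1)] by auto
qed

lemma full_trimmed_sylvester_rankI:
  assumes M: "M \<in> row_degree_mats m n d"
    and "\<And>k. k \<ge> 1 \<Longrightarrow> sylvester_inj d (m + n) k M \<or> sylvester_surj d (m + n) k M"
  shows "full_trimmed_sylvester_rank d M"
  unfolding full_trimmed_sylvester_rank_def Let_def
proof (intro allI impI)
  fix k :: nat assume k: "1 \<le> k"
  note T = trimmed_sylvester_carrier[OF m_pos length_d M, of k]
  have dim: "dim_row (trimmed_sylvester d k M) = k * m + sum_list d" "dim_row M = m" "dim_col M = m + n"
    using T M by (auto simp: row_degree_mats_def)
  have "min (k * m + sum_list d) (k * (m + n)) \<le>
      vec_space.rank (k * m + sum_list d) (trimmed_sylvester d k M)"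
    using assms(2)[OF k] rank_ge_if_sylvester_inj[OF M] rank_ge_if_sylvester_surj[OF M]
    by (meson min.coboundedI1 min.coboundedI2)
  then show "vec_space.rank (dim_row (trimmed_sylvester d k M)) (trimmed_sylvester d k M) =
      min (k * dim_row M + sum_list d) (k * dim_col M)"
    unfolding dim using vec_space_rank_le_nr[OF T] vec_space.rank_le_nc[OF T] by simp
qed

section \<open>Stability of full trimmed Sylvester rank\<close>

context
  fixes M M' :: "'a :: normed_conjugatable_field poly mat"
  assumes M: "M \<in> row_degree_mats m n d" and M': "M' \<in> row_degree_mats m n d"
    and splits: "\<And>p q (A :: 'a mat). A \<in> carrier_mat p q \<Longrightarrow>
      \<exists>es. char_poly (mat_adjoint A * A) = (\<Prod>e\<leftarrow>es. [:- e, 1:])"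
begin

lemma trimmed_sylvester_perturbation:
  assumes k: "k \<ge> 1" and j: "1 \<le> j" "j \<le> min (k * m + sum_list d) (k * (m + n))"
    and near: "spectral_norm (trimmed_sylvester d 1 M - trimmed_sylvester d 1 M')
      < singular_value j (trimmed_sylvester d k M) / sqrt (real k)"
  obtains P where "P \<in> carrier_mat (k * (m + n)) j"
    and "\<And>z. z \<in> carrier_vec j \<Longrightarrow>
      trimmed_sylvester d k M' * P *\<^sub>v z = 0\<^sub>v (k * m + sum_list d) \<Longrightarrow> z = 0\<^sub>v j"
proof (rule singular_value_perturbation[OF _ _ j splits])
  show "trimmed_sylvester d k M \<in> carrier_mat (k * m + sum_list d) (k * (m + n))"
    "trimmed_sylvester d k M' \<in> carrier_mat (k * m + sum_list d) (k * (m + n))"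
    by (intro trimmed_sylvester_carrier m_pos length_d M M')+
  then show "trimmed_sylvester d k M \<in> carrier_mat (k * m + sum_list d) (k * (m + n))" by simp
  let ?N = "spectral_norm (trimmed_sylvester d 1 M - trimmed_sylvester d 1 M')"
  show "sqrt (real k) * ?N < singular_value j (trimmed_sylvester d k M)"
    using near k by (simp add: field_simps)
  show "vec_norm2 ((trimmed_sylvester d k M - trimmed_sylvester d k M') *\<^sub>v x)
      \<le> sqrt (real k) * ?N * vec_norm2 x" if "x \<in> carrier_vec (k * (m + n))" for x
    using trimmed_sylvester_norm_bound[OF trimmed_sylvester_minus(1)[OF M M'] that]
    unfolding trimmed_sylvester_minus(2)[OF M M'] .
qed (use that in blast)

text \<open>\<open>k'\<close> is the least index at which the trimmed matrix has at least as many
  columns as rows, and \<open>t\<close> is the excess of columns there. Surjectivity at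
  \<open>k'\<close> settles all larger indices; injectivity at \<open>k' - 1\<close>, or at
  \<open>k'\<close> when \<open>t = 0\<close>, settles the smaller ones.\<close>

theorem full_trimmed_sylvester_rank_perturbation:
  fixes k' t :: nat
  assumes n: "n > 0" and d_pos: "sum_list d > 0"
    and k': "k' = nat \<lceil>real (sum_list d) / real n\<rceil>" and t: "n * k' = sum_list d + t"
    and tall: "k' > 1 \<Longrightarrow> t > 0 \<Longrightarrow>
      spectral_norm (trimmed_sylvester d 1 M - trimmed_sylvester d 1 M')
        < singular_value ((k' - 1) * (m + n)) (trimmed_sylvester d (k' - 1) M) / sqrt (real (k' - 1))"
    and wide: "spectral_norm (trimmed_sylvester d 1 M - trimmed_sylvester d 1 M')
        < singular_value (k' * m + sum_list d) (trimmed_sylvester d k' M) / sqrt (real k')"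
  shows "full_trimmed_sylvester_rank d M'"
proof (rule full_trimmed_sylvester_rankI[OF M'])
  have k'_pos: "k' \<ge> 1"
  proof (rule ccontr)
    assume "\<not> k' \<ge> 1"
    then have "k' = 0" by simp
    then have "0 = sum_list d + t" using t by (metis mult_0_right)
    then show False using d_pos by linarith
  qed
  \<comment> \<open>A ceiling exceeds its argument by less than 1. Hence at index
    \<open>k' - 1\<close> there are more rows than columns, which makes
    \<open>(k' - 1) * (m + n)\<close> an admissible singular value index.\<close>
  have "real_of_int \<lceil>real (sum_list d) / real n\<rceil> - 1 < real (sum_list d) / real n"
    by linarith
  then have "real k' - 1 < real (sum_list d) / real n"
    using k' k'_pos by linarith
  then have "real n * (real k' - 1) < real (sum_list d)" using n by (simp add: field_simps)
  then have "real (n * (k' - 1)) < real (sum_list d)" using k'_pos by (simp add: of_nat_diff)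
  then have pred_k': "n * (k' - 1) < sum_list d" by (simp only: of_nat_less_iff)
  have le: "k' * m + sum_list d \<le> k' * (m + n)"
    using t by (simp add: algebra_simps)
  obtain P where P: "P \<in> carrier_mat (k' * (m + n)) (k' * m + sum_list d)"
    "\<And>z. z \<in> carrier_vec (k' * m + sum_list d) \<Longrightarrow>
      trimmed_sylvester d k' M' * P *\<^sub>v z = 0\<^sub>v (k' * m + sum_list d) \<Longrightarrow> z = 0\<^sub>v (k' * m + sum_list d)"
    using trimmed_sylvester_perturbation[OF k'_pos _ _ wide] le d_pos by auto
  have surj: "sylvester_surj d (m + n) k' M'"
    by (rule sylvester_surj_if_mult_inj[OF M' P])
  fix k :: nat assume k: "k \<ge> 1"
  show "sylvester_inj d (m + n) k M' \<or> sylvester_surj d (m + n) k M'"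
  proof (cases "k' \<le> k")
    case True
    then show ?thesis using sylvester_surj_mono[OF m_pos length_d M' surj k'_pos] by blast
  next
    case False
    have "sylvester_inj d (m + n) k M'"
    proof (cases "t = 0")
      case True
      \<comment> \<open>The trimmed matrix at \<open>k'\<close> is square, so the same
        \<open>P\<close> also gives injectivity there.\<close>
      then have eq: "k' * m + sum_list d = k' * (m + n)" using t by (simp add: algebra_simps)
      have "sylvester_inj d (m + n) k' M'"
        by (rule sylvester_inj_if_mult_inj[OF M' P[unfolded eq]]) (simp_all only: eq)
      then show ?thesis using sylvester_inj_antimono[OF m_pos length_d M'] False by auto
    next
      case t0: False
      \<comment> \<open>An index \<open>k\<close> with \<open>1 \<le> k < k'\<close> exists here, so
        \<open>k' > 1\<close> and the premise \<open>tall\<close> becomes available.\<close>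
      have pos: "k' - 1 \<ge> 1" "k' > 1" "t > 0" using k False t0 by auto
      have j: "1 \<le> (k' - 1) * (m + n)"
        "(k' - 1) * (m + n) \<le> min ((k' - 1) * m + sum_list d) ((k' - 1) * (m + n))"
        using pos(1) n pred_k' by (simp_all add: Suc_le_eq distrib_left mult.commute[of n])
      obtain P where P: "P \<in> carrier_mat ((k' - 1) * (m + n)) ((k' - 1) * (m + n))"
        "\<And>z. z \<in> carrier_vec ((k' - 1) * (m + n)) \<Longrightarrow>
          trimmed_sylvester d (k' - 1) M' * P *\<^sub>v z = 0\<^sub>v ((k' - 1) * m + sum_list d) \<Longrightarrow>
          z = 0\<^sub>v ((k' - 1) * (m + n))"
        using trimmed_sylvester_perturbation[OF pos(1) j tall[OF pos(2,3)]] by blast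
      have "sylvester_inj d (m + n) (k' - 1) M'"
        by (rule sylvester_inj_if_mult_inj[OF M' P])
      then show ?thesis using sylvester_inj_antimono[OF m_pos length_d M'] False by auto
    qed
    then show ?thesis ..
  qed
qed

end

end

theorem theorem7p3:
  fixes m n k' t :: nat and d :: "nat list"
  assumes "m > 0" and "n > 0"
    and "length d = m" and "Max (set d) > 0"
    and "k' = nat \<lceil>real (sum_list d) / real n\<rceil>"
    and "n * k' = sum_list d + t"
  shows "(\<forall>M \<in> row_degree_mats m n d :: real poly mat set.
        full_trimmed_sylvester_rank d M \<longrightarrow>
        (k' > 1 \<and> t > 0 \<longrightarrow>
          (\<forall>M' \<in> row_degree_mats m n d.
            spectral_norm (trimmed_sylvester d 1 M - trimmed_sylvester d 1 M')
              < min (singular_value ((k' - 1) * (m + n)) (trimmed_sylvester d (k' - 1) M)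
                       / sqrt (real (k' - 1)))
                    (singular_value (k' * m + sum_list d) (trimmed_sylvester d k' M)
                       / sqrt (real k'))
            \<longrightarrow> full_trimmed_sylvester_rank d M')) \<and>
        (k' = 1 \<or> t = 0 \<longrightarrow>
          (\<forall>M' \<in> row_degree_mats m n d.
            spectral_norm (trimmed_sylvester d 1 M - trimmed_sylvester d 1 M')
              < singular_value (k' * m + sum_list d) (trimmed_sylvester d k' M)
                  / sqrt (real k')
            \<longrightarrow> full_trimmed_sylvester_rank d M'))) \<and>
     (\<forall>M \<in> row_degree_mats m n d :: complex poly mat set.
        full_trimmed_sylvester_rank d M \<longrightarrow>
        (k' > 1 \<and> t > 0 \<longrightarrow>
          (\<forall>M' \<in> row_degree_mats m n d.
            spectral_norm (trimmed_sylvester d 1 M - trimmed_sylvester d 1 M')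
              < min (singular_value ((k' - 1) * (m + n)) (trimmed_sylvester d (k' - 1) M)
                       / sqrt (real (k' - 1)))
                    (singular_value (k' * m + sum_list d) (trimmed_sylvester d k' M)
                       / sqrt (real k'))
            \<longrightarrow> full_trimmed_sylvester_rank d M')) \<and>
        (k' = 1 \<or> t = 0 \<longrightarrow>
          (\<forall>M' \<in> row_degree_mats m n d.
            spectral_norm (trimmed_sylvester d 1 M - trimmed_sylvester d 1 M')
              < singular_value (k' * m + sum_list d) (trimmed_sylvester d k' M)
                  / sqrt (real k')
            \<longrightarrow> full_trimmed_sylvester_rank d M')))"
proof -
  have "sum_list d > 0"
  proof -
    have "Max (set d) \<in> set d" using assms(1,3) by (intro Max_in) auto
    then have "Max (set d) \<le> sum_list d" by (intro member_le_sum_list) simp_all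
    then show ?thesis using assms(4) by simp
  qed
  note real = full_trimmed_sylvester_rank_perturbation[OF assms(1,3) _ _
      char_poly_gram_splits_real assms(2) this assms(5,6)]
  note complex = full_trimmed_sylvester_rank_perturbation[OF assms(1,3) _ _
      char_poly_gram_splits_complex assms(2) \<open>sum_list d > 0\<close> assms(5,6)]
  \<comment> \<open>In (a) the minimum yields both bounds; in (b) the premise \<open>tall\<close>
    holds vacuously.\<close>
  show ?thesis
    by (intro conjI ballI impI; (rule real | rule complex)) auto
qed

end
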